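(* The Farey graph $F$ is a tightly typical $\Pi$-graph, and every tightly typical $\Pi$-graph is tightly minor-equivalent to $F$. In other words, up to tight minor-equivalence, the Farey graph is the unique tightly typical $\Pi$-graph.
   Context: Graphs are simple and may be infinite. The Farey graph $F$ is the graph with vertex set $\mathbb{Q}\cup\{\infty\}$ in which two rationals $a/b$ and $c/d$ written in lowest terms (allowing $\infty=(\pm1)/0$) are adjacent if and only if $ad-bc=\pm1$. A graph is infinitely edge-connected if it has at least two vertices and $G-E'$ is connected for every finite set $E'$ of edges. Paths are independent if they are internally vertex-disjoint. A $\Pi$-graph is an infinitely edge-connected graph that does not contain infinitely many independent paths between any two of its vertices. A graph $H$ is a minor of $G$ if there are pairwise disjoint non-empty vertex sets $V_h\subseteq V(G)$ ($h\in V(H)$), each inducing a connected subgraph of $G$ (the branch sets), such that for every edge $hh'$ of $H$ there is an edge of $G$ between $V_h$ and $V_{h'}$. A tight minor is a minor all of whose branch sets are finite. Two graphs are tightly minor-equivalent if each is a tight minor of the other. A $\Pi$-graph is tightly typical if it occurs as a tight minor in every $\Pi$-graph. *)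

theory Defs
  imports Main "HOL.Rat"
begin

definition graph :: "'a set \<Rightarrow> ('a \<Rightarrow> 'a \<Rightarrow> bool) \<Rightarrow> bool" where
  "graph V E \<longleftrightarrow> (\<forall>x y. E x y \<longrightarrow> x \<in> V \<and> y \<in> V) \<and> (\<forall>x y. E x y \<longrightarrow> E y x) \<and> (\<forall>x. \<not> E x x)"

definition connected_set :: "('a \<Rightarrow> 'a \<Rightarrow> bool) \<Rightarrow> 'a set \<Rightarrow> bool" where
  "connected_set E B \<longleftrightarrow> (\<forall>x\<in>B. \<forall>y\<in>B. (\<lambda>a b. E a b \<and> a \<in> B \<and> b \<in> B)\<^sup>*\<^sup>* x y)"

definition delete_edges :: "('a \<Rightarrow> 'a \<Rightarrow> bool) \<Rightarrow> 'a set set \<Rightarrow> 'a \<Rightarrow> 'a \<Rightarrow> bool" where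
  "delete_edges E S x y \<longleftrightarrow> E x y \<and> {x, y} \<notin> S"

definition inf_edge_connected :: "'a set \<Rightarrow> ('a \<Rightarrow> 'a \<Rightarrow> bool) \<Rightarrow> bool" where
  "inf_edge_connected V E \<longleftrightarrow> graph V E \<and> (\<exists>x\<in>V. \<exists>y\<in>V. x \<noteq> y) \<and>
     (\<forall>S. finite S \<longrightarrow> S \<subseteq> {{x, y} | x y. E x y} \<longrightarrow> connected_set (delete_edges E S) V)"

definition is_path :: "('a \<Rightarrow> 'a \<Rightarrow> bool) \<Rightarrow> 'a \<Rightarrow> 'a \<Rightarrow> 'a list \<Rightarrow> bool" where
  "is_path E u v p \<longleftrightarrow> p \<noteq> [] \<and> distinct p \<and> hd p = u \<and> last p = v \<and> successively E p"

definition inner_vertices :: "'a list \<Rightarrow> 'a set" where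
  "inner_vertices p = set (butlast (tl p))"

definition infinitely_many_independent_paths :: "('a \<Rightarrow> 'a \<Rightarrow> bool) \<Rightarrow> 'a \<Rightarrow> 'a \<Rightarrow> bool" where
  "infinitely_many_independent_paths E u v \<longleftrightarrow>
     (\<exists>P. infinite P \<and> (\<forall>p\<in>P. is_path E u v p) \<and>
          (\<forall>p\<in>P. \<forall>q\<in>P. p \<noteq> q \<longrightarrow> inner_vertices p \<inter> inner_vertices q = {}))"

definition pi_graph :: "'a set \<Rightarrow> ('a \<Rightarrow> 'a \<Rightarrow> bool) \<Rightarrow> bool" where
  "pi_graph V E \<longleftrightarrow> inf_edge_connected V E \<and>
     \<not> (\<exists>u\<in>V. \<exists>v\<in>V. u \<noteq> v \<and> infinitely_many_independent_paths E u v)"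

definition minor_via :: "'h set \<Rightarrow> ('h \<Rightarrow> 'h \<Rightarrow> bool) \<Rightarrow> 'g set \<Rightarrow> ('g \<Rightarrow> 'g \<Rightarrow> bool) \<Rightarrow> ('h \<Rightarrow> 'g set) \<Rightarrow> bool" where
  "minor_via VH EH VG EG br \<longleftrightarrow>
     (\<forall>h\<in>VH. br h \<noteq> {} \<and> br h \<subseteq> VG \<and> connected_set EG (br h)) \<and>
     (\<forall>h\<in>VH. \<forall>h'\<in>VH. h \<noteq> h' \<longrightarrow> br h \<inter> br h' = {}) \<and>
     (\<forall>h h'. EH h h' \<longrightarrow> (\<exists>x\<in>br h. \<exists>y\<in>br h'. EG x y))"

definition minor :: "'h set \<Rightarrow> ('h \<Rightarrow> 'h \<Rightarrow> bool) \<Rightarrow> 'g set \<Rightarrow> ('g \<Rightarrow> 'g \<Rightarrow> bool) \<Rightarrow> bool" where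
  "minor VH EH VG EG \<longleftrightarrow> (\<exists>br. minor_via VH EH VG EG br)"

definition tight_minor :: "'h set \<Rightarrow> ('h \<Rightarrow> 'h \<Rightarrow> bool) \<Rightarrow> 'g set \<Rightarrow> ('g \<Rightarrow> 'g \<Rightarrow> bool) \<Rightarrow> bool" where
  "tight_minor VH EH VG EG \<longleftrightarrow> (\<exists>br. minor_via VH EH VG EG br \<and> (\<forall>h\<in>VH. finite (br h)))"

definition tightly_minor_equivalent :: "'h set \<Rightarrow> ('h \<Rightarrow> 'h \<Rightarrow> bool) \<Rightarrow> 'g set \<Rightarrow> ('g \<Rightarrow> 'g \<Rightarrow> bool) \<Rightarrow> bool" where
  "tightly_minor_equivalent VH EH VG EG \<longleftrightarrow> tight_minor VH EH VG EG \<and> tight_minor VG EG VH EH"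

text \<open>Farey graph on Q \<union> {\<infinity>}, with None = \<infinity> = 1/0. Numerator/denominator
in lowest terms via quotient_of (denominator positive).\<close>
fun frac :: "rat option \<Rightarrow> int \<times> int" where
  "frac None = (1, 0)"
| "frac (Some q) = quotient_of q"

definition farey :: "rat option \<Rightarrow> rat option \<Rightarrow> bool" where
  "farey x y \<longleftrightarrow> (let (a, b) = frac x; (c, d) = frac y in \<bar>a * d - b * c\<bar> = 1)"

end

theory Submission
  imports Defs "HOL-Library.Countable_Set"
begin

text \<open>
  Fix an edge between two vertices of a \<open>\<Pi>\<close>-graph; no finite edge set separates its ends. More
  generally let \<open>A\<close> and \<open>B\<close> be disjoint finite connected sets that no finite edge set separates
  inside a vertex set \<open>D\<close>. Since there are no infinitely many independent paths, a finite
  \<open>X \<subseteq> D\<close> meets the interior of every \<open>A\<close>--\<open>B\<close> walk through \<open>D\<close> other than a direct edge. By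
  pigeonhole there are \<open>x, y \<in> X\<close> such that for every finite edge set \<open>S\<close> some \<open>A\<close>--\<open>B\<close> walk
  avoiding \<open>S\<close> has \<open>x\<close> as its first and \<open>y\<close> as its last vertex in \<open>X\<close>. The interior \<open>Z\<close> of one
  such walk is finite, connected and adjacent to \<open>A\<close> and \<open>B\<close>, and it inherits the hypothesis
  towards \<open>A\<close> and towards \<open>B\<close> within disjoint parts of \<open>D\<close>, because \<open>X\<close> separates these parts.
  Iterating along the Stern--Brocot tree produces the part of the Farey graph on one side of an
  edge. The whole Farey graph arises from two such halves, over the pairs \<open>A, Z\<close> and \<open>Z, B\<close>, by
  taking \<open>Z\<close> as the branch set of 0 and \<open>A \<union> B\<close> as the branch set of \<open>\<infinity>\<close>.

  The Farey graph is infinitely edge-connected because an edge \<open>xy\<close> can be replaced by the path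
  through the mediant of \<open>x\<close> and \<open>y\<close>, whose edges are higher. Moving \<open>u\<close> to \<open>\<infinity>\<close> by a unimodular
  map, any path from \<open>u\<close> to \<open>v\<close> other than a direct edge passes through one of the at most three
  integers next to \<open>v\<close>, since no Farey edge jumps over an integer.
\<close>

section \<open>Splitting linkages\<close>

lemma rtranclp_distinct_walk:
  assumes "R\<^sup>*\<^sup>* x y"
  shows "\<exists>xs. xs \<noteq> [] \<and> distinct xs \<and> hd xs = x \<and> last xs = y \<and> successively R xs"
  using assms
proof (induction rule: converse_rtranclp_induct)
  case base
  show ?case by (rule exI[of _ "[y]"]) simp
next
  case (step x z)
  then obtain xs where xs: "xs \<noteq> []" "distinct xs" "hd xs = z" "last xs = y" "successively R xs"
    by blast
  show ?case
  proof (cases "x \<in> set xs")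
    case True
    then obtain ys zs where "xs = ys @ x # zs" by (meson split_list)
    with xs show ?thesis
      by (intro exI[of _ "x # zs"]) (auto simp: successively_append_iff)
  next
    case False
    with xs step(1) show ?thesis
      by (intro exI[of _ "x # xs"]) (cases xs; auto)
  qed
qed

lemma walk_set_subset:
  assumes "successively R xs" "xs \<noteq> [] \<Longrightarrow> hd xs \<in> V" "\<And>a b. R a b \<Longrightarrow> b \<in> V"
  shows "set xs \<subseteq> V"
  using assms by (induction xs rule: induct_list012) auto

lemma walk_imp_rtranclp:
  assumes "successively R xs" "xs \<noteq> []"
  shows "(\<lambda>a b. R a b \<and> a \<in> set xs \<and> b \<in> set xs)\<^sup>*\<^sup>* (hd xs) (last xs)"
  using assms
proof (induction xs rule: induct_list012)
  case (3 x y zs)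
  let ?R = "\<lambda>X a b. R a b \<and> a \<in> X \<and> b \<in> X"
  have "(?R (set (y # zs)))\<^sup>*\<^sup>* y (last (y # zs))" using 3 by simp
  then have "(?R (set (x # y # zs)))\<^sup>*\<^sup>* y (last (y # zs))"
    by (rule rtranclp_mono[THEN predicate2D, rotated]) auto
  moreover have "?R (set (x # y # zs)) x y" using 3 by simp
  ultimately show ?case by (auto intro: converse_rtranclp_into_rtranclp)
qed auto

lemma walk_distinct:
  assumes "successively R xs" "xs \<noteq> []"
  shows "\<exists>ys. ys \<noteq> [] \<and> distinct ys \<and> hd ys = hd xs \<and> last ys = last xs \<and>
           set ys \<subseteq> set xs \<and> successively R ys"
proof -
  obtain ys where ys: "ys \<noteq> []" "distinct ys" "hd ys = hd xs" "last ys = last xs"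
    and suc: "successively (\<lambda>a b. R a b \<and> a \<in> set xs \<and> b \<in> set xs) ys"
    using rtranclp_distinct_walk[OF walk_imp_rtranclp[OF assms]] by blast
  have "set ys \<subseteq> set xs"
    using suc by (rule walk_set_subset) (use ys assms in auto)
  with ys suc show ?thesis by (metis (mono_tags, lifting) successively_mono)
qed

lemma rtranclp_sym: "symp R \<Longrightarrow> R\<^sup>*\<^sup>* x y \<Longrightarrow> R\<^sup>*\<^sup>* y x"
  by (metis sympD symp_rtranclp)

lemma connected_set_walk:
  assumes sym: "symp E" and "successively E xs"
  shows "connected_set E (set xs)"
proof (cases "xs = []")
  case False
  let ?R = "\<lambda>a b. E a b \<and> a \<in> set xs \<and> b \<in> set xs"
  have symR: "symp ?R" using sym by (auto simp: symp_def)
  have reach: "?R\<^sup>*\<^sup>* (hd xs) z" if "z \<in> set xs" for z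
  proof -
    obtain ys zs where s: "xs = ys @ z # zs" using \<open>z \<in> set xs\<close> by (meson split_list)
    then have "successively E (ys @ [z])" using assms(2) by (simp add: successively_append_iff)
    from walk_imp_rtranclp[OF this]
    have "(\<lambda>a b. E a b \<and> a \<in> set (ys @ [z]) \<and> b \<in> set (ys @ [z]))\<^sup>*\<^sup>* (hd xs) z"
      using s by (auto simp: hd_append)
    then show ?thesis
      by (rule rtranclp_mono[THEN predicate2D, rotated]) (auto simp: s)
  qed
  show ?thesis
    unfolding connected_set_def
    using reach rtranclp_sym[OF symR] by (meson rtranclp_trans)
qed (simp add: connected_set_def)

lemma connected_set_Un:
  assumes sym: "symp E" and A: "connected_set E A" and B: "connected_set E B"
    and ab: "a \<in> A" "b \<in> B" "E a b"
  shows "connected_set E (A \<union> B)"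
proof -
  let ?R = "\<lambda>X a b. E a b \<and> a \<in> X \<and> b \<in> X"
  have symR: "symp (?R (A \<union> B))" using sym by (auto simp: symp_def)
  have 1: "(?R (A \<union> B))\<^sup>*\<^sup>* x y" if "x \<in> A" "y \<in> A" for x y
    using A that unfolding connected_set_def
    by (blast intro: rtranclp_mono[THEN predicate2D, rotated])
  have 2: "(?R (A \<union> B))\<^sup>*\<^sup>* x y" if "x \<in> B" "y \<in> B" for x y
    using B that unfolding connected_set_def
    by (blast intro: rtranclp_mono[THEN predicate2D, rotated])
  have "?R (A \<union> B) a b" using ab by auto
  then have a_to: "(?R (A \<union> B))\<^sup>*\<^sup>* a z" if "z \<in> A \<union> B" for z
    using 1[OF ab(1)] 2[OF ab(2)] that by (auto intro: converse_rtranclp_into_rtranclp)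
  then show ?thesis
    unfolding connected_set_def using rtranclp_sym[OF symR] by (meson rtranclp_trans)
qed

section \<open>Linkages that survive every finite deletion of edges\<close>

definition linked :: "('a \<Rightarrow> 'a \<Rightarrow> bool) \<Rightarrow> 'a set \<Rightarrow> 'a set \<Rightarrow> 'a set \<Rightarrow> bool" where
  "linked R A D B \<longleftrightarrow> (\<exists>a\<in>A. \<exists>b\<in>B. \<exists>p. set p \<subseteq> D \<and> successively R (a # p @ [b]))"

lemma successively_rev_sym:
  assumes "symp R"
  shows "successively R (rev xs) \<longleftrightarrow> successively R xs"
proof -
  have "(\<lambda>x y. R y x) = R" using assms by (auto simp: fun_eq_iff dest: sympD)
  then show ?thesis by (simp only: successively_rev)
qed

lemma linked_sym:
  assumes "symp R" "linked R A D B"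
  shows "linked R B D A"
proof -
  from assms(2) obtain a b p where *: "a \<in> A" "b \<in> B" "set p \<subseteq> D" "successively R (a # p @ [b])"
    unfolding linked_def by blast
  then have "successively R (b # rev p @ [a])"
    using successively_rev_sym[OF assms(1), of "a # p @ [b]"] by simp
  with * show ?thesis unfolding linked_def by (metis set_rev)
qed

text \<open>Cutting the walk at its first vertex in \<open>Z\<close> removes \<open>Z\<close> from
  the reservoir; \<open>linkage\<close> demands a reservoir disjoint from both ends.\<close>

lemma linked_avoiding_end:
  assumes "linked R A D Z" "D \<subseteq> D' \<union> Z"
  shows "linked R A (D' - Z) Z"
proof -
  from assms(1) obtain a b p where *: "a \<in> A" "b \<in> Z" "set p \<subseteq> D" "successively R (a # p @ [b])"
    unfolding linked_def by blast
  obtain p1 z p2 where s: "p @ [b] = p1 @ z # p2" "z \<in> Z" "\<forall>y\<in>set p1. y \<notin> Z"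
    using split_list_first_prop[of "p @ [b]" "\<lambda>y. y \<in> Z"] \<open>b \<in> Z\<close> by auto
  have "set p1 \<subseteq> set (p @ [b])" using s by auto
  then have "set p1 \<subseteq> D' - Z" using s(3) *(2,3) assms(2) by fastforce
  moreover have "successively R (a # p1 @ [z])"
    using *(4) unfolding s(1)
    by (metis append_Cons append_assoc append_Nil successively_append_iff)
  ultimately show ?thesis using * s unfolding linked_def by blast
qed

lemma symp_delete_edges: "symp E \<Longrightarrow> symp (delete_edges E S)"
  by (auto simp: symp_def delete_edges_def insert_commute)

lemma successively_delete_edges_mono:
  assumes "successively (delete_edges E S) xs" "T \<subseteq> S"
  shows "successively (delete_edges E T) xs"
  by (rule successively_mono[OF assms(1)]) (use assms(2) in \<open>auto simp: delete_edges_def\<close>)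

lemma successively_delete_edgesD: 
  assumes "successively (delete_edges E S) xs"
  shows "successively E xs"
  by (rule successively_mono[OF assms]) (simp add: delete_edges_def)

text \<open>The invariant of the recursion: \<open>D\<close> is the reservoir from which all later branch sets
  between the branch sets \<open>A\<close> and \<open>B\<close> are taken.\<close>
definition linkage :: "('a \<Rightarrow> 'a \<Rightarrow> bool) \<Rightarrow> 'a set \<Rightarrow> 'a set \<Rightarrow> 'a set \<Rightarrow> bool" where
  "linkage E A D B \<longleftrightarrow> finite A \<and> finite B \<and> connected_set E A \<and> connected_set E B \<and>
     A \<noteq> {} \<and> B \<noteq> {} \<and> A \<inter> B = {} \<and> A \<inter> D = {} \<and> B \<inter> D = {} \<and>
     (\<exists>a\<in>A. \<exists>b\<in>B. E a b) \<and> (\<forall>S. finite S \<longrightarrow> linked (delete_edges E S) A D B)"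

lemma linkage_sym:
  assumes "symp E" "linkage E A D B"
  shows "linkage E B D A"
  using assms linked_sym[OF symp_delete_edges[OF assms(1)]]
  unfolding linkage_def by (auto dest: sympD)

text \<open>If every finite set fails, walks can be chosen one after another, each avoiding the
  interiors of all earlier ones. As \<open>A\<close> and \<open>B\<close> are finite, infinitely
  many of them share both ends and form independent paths.\<close>

lemma finite_separator:
  assumes fin: "finite A" "finite B" and disj: "A \<inter> B = {}" "A \<inter> D = {}" "B \<inter> D = {}"
    and no: "\<And>a b. a \<in> A \<Longrightarrow> b \<in> B \<Longrightarrow> \<not> infinitely_many_independent_paths E a b"
  shows "\<exists>X. finite X \<and> \<not> (\<exists>a\<in>A. \<exists>b\<in>B. \<exists>p. p \<noteq> [] \<and> set p \<subseteq> D - X \<and> successively E (a # p @ [b]))"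
proof (rule ccontr)
  assume neg: "\<not> ?thesis"
  have "\<exists>a p b. finite X \<longrightarrow> a \<in> A \<and> b \<in> B \<and> p \<noteq> [] \<and> distinct p \<and> set p \<subseteq> D - X \<and>
      successively E (a # p @ [b])" for X
  proof (cases "finite X")
    case True
    then obtain a b p where *: "a \<in> A" "b \<in> B" "p \<noteq> []" "set p \<subseteq> D - X" "successively E (a # p @ [b])"
      using neg by blast
    then have "successively E p" by (simp add: successively_append_iff successively_Cons)
    then obtain q where "q \<noteq> []" "distinct q" "hd q = hd p" "last q = last p"
      "set q \<subseteq> set p" "successively E q"
      using walk_distinct * by blast
    with * show ?thesis
      by (intro exI[of _ a] exI[of _ q] exI[of _ b])
        (auto simp: successively_append_iff successively_Cons)
  qed auto
  then obtain a0 p0 b0 where g: "\<And>X. finite X \<Longrightarrow> a0 X \<in> A \<and> b0 X \<in> B \<and> p0 X \<noteq> [] \<and>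
      distinct (p0 X) \<and> set (p0 X) \<subseteq> D - X \<and> successively E (a0 X # p0 X @ [b0 X])"
    by metis
  \<comment> \<open>\<open>Y n\<close> is the union of the interiors of the first \<open>n\<close>
    chosen walks.\<close>
  define Y where "Y = rec_nat {} (\<lambda>_ X. X \<union> set (p0 X))"
  have Y_Suc: "Y (Suc n) = Y n \<union> set (p0 (Y n))" for n
    by (simp add: Y_def)
  have Y_fin: "finite (Y n)" for n by (induction n) (simp_all add: Y_Suc, simp add: Y_def)
  have Y_mono: "Y m \<subseteq> Y n" if "m \<le> n" for m n
    using that by (rule lift_Suc_mono_le[rotated]) (auto simp: Y_Suc)
  define a p b where "a n = a0 (Y n)" and "p n = p0 (Y n)" and "b n = b0 (Y n)" for n
  have w: "a n \<in> A" "b n \<in> B" "p n \<noteq> []" "distinct (p n)" "set (p n) \<subseteq> D - Y n"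
      "successively E (a n # p n @ [b n])" for n
    using g[OF Y_fin[of n]] by (auto simp: a_def p_def b_def)
  have lt: "set (p m) \<inter> set (p n) = {}" if "m < n" for m n
  proof -
    have "set (p m) \<subseteq> Y (Suc m)" by (simp add: Y_Suc p_def)
    also have "\<dots> \<subseteq> Y n" using that by (intro Y_mono) simp
    finally show ?thesis using w(5)[of n] by blast
  qed
  have p_disj: "set (p m) \<inter> set (p n) = {}" if "m \<noteq> n" for m n
    using lt[of m n] lt[of n m] that by (cases "m < n") auto
  have "(\<lambda>n. (a n, b n)) ` UNIV \<subseteq> A \<times> B" using w by auto
  then have "finite ((\<lambda>n. (a n, b n)) ` UNIV)" by (rule finite_subset) (simp add: fin)
  then obtain k where inf: "infinite {n. (a n, b n) = (a k, b k)}"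
    using pigeonhole_infinite[of "UNIV :: nat set" "\<lambda>n. (a n, b n)"] by auto
  define N where "N = {n. (a n, b n) = (a k, b k)}"
  define P where "P = (\<lambda>n. a k # p n @ [b k]) ` N"
  have "inj_on (\<lambda>n. a k # p n @ [b k]) N"
  proof (rule inj_onI)
    fix m n assume "a k # p m @ [b k] = a k # p n @ [b k]"
    then have "p m = p n" by simp
    then show "m = n" using p_disj[of m n] w(3)[of m] by fastforce
  qed
  then have "infinite P" using inf unfolding P_def N_def by (simp add: finite_image_iff)
  moreover have "is_path E (a k) (b k) q" if "q \<in> P" for q
  proof -
    obtain n where n: "n \<in> N" "q = a k # p n @ [b k]" using \<open>q \<in> P\<close> by (auto simp: P_def)
    have e: "a n = a k" "b n = b k" using n by (auto simp: N_def)
    have "set (p n) \<subseteq> D" using w(5)[of n] by blast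
    moreover have "a k \<notin> D" "b k \<notin> D" "a k \<noteq> b k"
      using w(1)[of k] w(2)[of k] disj by auto
    ultimately have "a k \<notin> set (p n)" "b k \<notin> set (p n)" "a k \<noteq> b k" by auto
    then show ?thesis using w[of n] n unfolding is_path_def e by auto
  qed
  moreover have "inner_vertices q \<inter> inner_vertices r = {}" if "q \<in> P" "r \<in> P" "q \<noteq> r" for q r
  proof -
    obtain m n where "q = a k # p m @ [b k]" "r = a k # p n @ [b k]"
      using \<open>q \<in> P\<close> \<open>r \<in> P\<close> by (auto simp: P_def)
    then show ?thesis using p_disj[of m n] \<open>q \<noteq> r\<close> by (auto simp: inner_vertices_def)
  qed
  ultimately have "infinitely_many_independent_paths E (a k) (b k)"
    unfolding infinitely_many_independent_paths_def by (intro exI[of _ P] conjI ballI impI) auto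
  then show False using no[OF w(1)[of k] w(2)[of k]] by simp
qed

lemma split_list_first_last_prop:
  assumes "\<exists>x\<in>set xs. P x"
  shows "\<exists>ys zs us. xs = ys @ zs @ us \<and> zs \<noteq> [] \<and> P (hd zs) \<and> P (last zs) \<and>
    (\<forall>y\<in>set ys. \<not> P y) \<and> (\<forall>y\<in>set us. \<not> P y)"
proof -
  obtain ys x rest where 1: "xs = ys @ x # rest" "P x" "\<forall>y\<in>set ys. \<not> P y"
    using split_list_first_prop[OF assms] by blast
  then have "\<exists>y\<in>set (x # rest). P y" by simp
  from split_list_last_prop[OF this] obtain zs y us where
    2: "x # rest = zs @ y # us" "P y" "\<forall>y\<in>set us. \<not> P y" by blast
  have "hd (zs @ [y]) = x" using 2(1) by (cases zs) auto
  with 1 2 show ?thesis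
    by (intro exI[of _ ys] exI[of _ "zs @ [y]"] exI[of _ us]) auto
qed

lemma linkage_split:
  assumes sym: "symp E" and lk: "linkage E A D B"
    and no: "\<And>a b. a \<in> A \<Longrightarrow> b \<in> B \<Longrightarrow> \<not> infinitely_many_independent_paths E a b"
  shows "\<exists>Z D1 D2. linkage E A D1 Z \<and> linkage E Z D2 B \<and> Z \<subseteq> D \<and> D1 \<subseteq> D \<and> D2 \<subseteq> D \<and> D1 \<inter> D2 = {}"
proof -
  have fin: "finite A" "finite B" and disj: "A \<inter> B = {}" "A \<inter> D = {}" "B \<inter> D = {}"
    and con: "connected_set E A" "connected_set E B" and ne: "A \<noteq> {}" "B \<noteq> {}"
    and lnk: "\<And>S. finite S \<Longrightarrow> linked (delete_edges E S) A D B"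
    using lk unfolding linkage_def by auto
  obtain X where X: "finite X"
    and sep: "\<And>a b p. a \<in> A \<Longrightarrow> b \<in> B \<Longrightarrow> p \<noteq> [] \<Longrightarrow> set p \<subseteq> D - X \<Longrightarrow> \<not> successively E (a # p @ [b])"
    using finite_separator[OF fin disj no] by metis
  \<comment> \<open>The outer pieces \<open>p\<close> and \<open>r\<close> avoid \<open>X\<close>;
    only the middle piece \<open>q\<close>, from \<open>x\<close> to \<open>y\<close>, may meet
    it.\<close>
  define W where "W S x y a p q r b \<longleftrightarrow> a \<in> A \<and> b \<in> B \<and> q \<noteq> [] \<and> hd q = x \<and> last q = y \<and>
    set (p @ q @ r) \<subseteq> D \<and> set p \<inter> X = {} \<and> set r \<inter> X = {} \<and>
    successively (delete_edges E S) (a # p @ q @ r @ [b])" for S x y a p q r b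
  \<comment> \<open>If a finite \<open>T x y\<close> blocked each pair, the finitely many
    \<open>T x y\<close> with \<open>x, y \<in> X\<close> together with all direct
    \<open>A\<close>--\<open>B\<close> edges would form a finite set that no linking walk
    avoids.\<close>
  have "\<exists>x y. \<forall>S. finite S \<longrightarrow> (\<exists>a p q r b. W S x y a p q r b)"
  proof (rule ccontr)
    assume "\<not> ?thesis"
    then obtain T where T: "\<And>x y. finite (T x y)" "\<And>x y a p q r b. \<not> W (T x y) x y a p q r b"
      by metis
    define S where "S = (\<Union>x\<in>X. \<Union>y\<in>X. T x y) \<union> (\<Union>a\<in>A. \<Union>b\<in>B. {{a, b}})"
    have "finite S" unfolding S_def using X T(1) fin by blast
    from lnk[OF this] obtain a b p where p: "a \<in> A" "b \<in> B" "set p \<subseteq> D"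
      "successively (delete_edges E S) (a # p @ [b])"
      unfolding linked_def by blast
    have "p \<noteq> []"
    proof
      assume "p = []"
      with p have "{a, b} \<notin> S" by (simp add: delete_edges_def)
      with p show False by (auto simp: S_def)
    qed
    then have "\<exists>x\<in>set p. x \<in> X"
      using sep[of a b p] p successively_delete_edgesD[OF p(4)] by blast
    from split_list_first_last_prop[OF this] obtain p1 q p3 where
      s: "p = p1 @ q @ p3" "q \<noteq> []" "hd q \<in> X" "last q \<in> X" "\<forall>y\<in>set p1. y \<notin> X" "\<forall>y\<in>set p3. y \<notin> X"
      by blast
    have "T (hd q) (last q) \<subseteq> S" using s by (auto simp: S_def)
    from successively_delete_edges_mono[OF p(4) this]
    have "W (T (hd q) (last q)) (hd q) (last q) a p1 q p3 b"
      using p s unfolding W_def by auto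
    then show False using T(2) by blast
  qed
  then obtain x y where xy: "\<And>S. finite S \<Longrightarrow> \<exists>a p q r b. W S x y a p q r b" by blast
  obtain a0 p0 q0 r0 b0 where W0: "W {} x y a0 p0 q0 r0 b0" using xy[of "{}"] by blast
  define Z where "Z = set (p0 @ q0 @ r0)"
  \<comment> \<open>\<open>C A\<close> and \<open>C B\<close> are the two sides of the separator
    \<open>X\<close>: what \<open>A\<close> and \<open>B\<close> reach inside \<open>D - X\<close>.
    They become the new reservoirs once \<open>Z\<close> is removed.\<close>
  define C where "C A' = {v \<in> D - X. \<exists>a\<in>A'. \<exists>p. set p \<subseteq> D - X \<and> successively E (a # p @ [v])}" for A'
  have Z: "Z \<subseteq> D" "finite Z" "Z \<noteq> {}" "x \<in> Z" "y \<in> Z"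
    using W0 by (auto simp: W_def Z_def)
  have suc0: "successively E (a0 # (p0 @ q0 @ r0) @ [b0])"
    using W0 successively_delete_edgesD by (fastforce simp: W_def)
  then have "successively E ((a0 # p0 @ q0 @ r0) @ [b0])" by simp
  then have "successively E (a0 # p0 @ q0 @ r0)" by (simp only: successively_append_iff)
  then have "successively E (p0 @ q0 @ r0)" by (simp only: successively_Cons) auto
  then have Zcon: "connected_set E Z" unfolding Z_def by (rule connected_set_walk[OF sym])
  have ne0: "p0 @ q0 @ r0 \<noteq> []" using W0 by (simp add: W_def)
  have "E a0 (hd (p0 @ q0 @ r0))" "E (last (p0 @ q0 @ r0)) b0"
    using suc0 ne0 by (auto simp: successively_append_iff successively_Cons simp del: append_assoc)
  then have adj: "\<exists>a\<in>A. \<exists>z\<in>Z. E a z" "\<exists>z\<in>Z. \<exists>b\<in>B. E z b"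
    using W0 hd_in_set[OF ne0] last_in_set[OF ne0] unfolding Z_def W_def by blast+
  have C_step: "linked (delete_edges E S) A' (C A' - Z) Z"
    if "a \<in> A'" "set p \<subseteq> D - X" "successively (delete_edges E S) (a # p @ [z])" "z \<in> Z" for S a A' p z
  proof -
    have "v \<in> C A'" if v: "v \<in> set p" for v
    proof -
      obtain p1 p2 where s: "p = p1 @ v # p2" using v by (meson split_list)
      have "successively (delete_edges E S) (a # p1 @ [v])"
        using \<open>successively (delete_edges E S) (a # p @ [z])\<close>
        unfolding s by (auto simp: successively_append_iff successively_Cons hd_append)
      then show ?thesis
        using successively_delete_edgesD s \<open>a \<in> A'\<close> \<open>set p \<subseteq> D - X\<close> unfolding C_def
        by (fastforce)
    qed
    then have "linked (delete_edges E S) A' (C A') Z" using that unfolding linked_def by blast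
    then show ?thesis by (rule linked_avoiding_end) auto
  qed
  \<comment> \<open>The same \<open>x\<close> serves every \<open>S\<close> and lies in
    \<open>Z\<close>, so the initial piece of a walk given by \<open>W\<close> always leads from
    \<open>A\<close> into \<open>Z\<close>.\<close>
  have lA: "linked (delete_edges E S) A (C A - Z) Z" if "finite S" for S
  proof -
    obtain a p q r b where W: "W S x y a p q r b" using xy[OF \<open>finite S\<close>] by blast
    then obtain q' where q: "q = x # q'" by (cases q) (auto simp: W_def)
    have "successively (delete_edges E S) ((a # p @ [x]) @ q' @ r @ [b])"
      using W unfolding W_def q by simp
    then have "successively (delete_edges E S) (a # p @ [x])"
      by (simp only: successively_append_iff)
    moreover have "a \<in> A" "set p \<subseteq> D - X" using W unfolding W_def by auto
    ultimately show ?thesis using C_step Z by blast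
  qed
  have lB: "linked (delete_edges E S) B (C B - Z) Z" if "finite S" for S
  proof -
    obtain a p q r b where W: "W S x y a p q r b" using xy[OF \<open>finite S\<close>] by blast
    then obtain q' where q: "q = q' @ [y]" by (cases q rule: rev_cases) (auto simp: W_def)
    have "successively (delete_edges E S) ((a # p @ q') @ (y # r @ [b]))"
      using W unfolding W_def q by simp
    then have "successively (delete_edges E S) (y # r @ [b])"
      by (simp only: successively_append_iff)
    \<comment> \<open>Read backwards, the final piece leads from \<open>B\<close> to
      \<open>y\<close>, which also lies in \<open>Z\<close>.\<close>
    then have "successively (delete_edges E S) (rev (y # r @ [b]))"
      by (simp only: successively_rev_sym[OF symp_delete_edges[OF sym]])
    then have "successively (delete_edges E S) (b # rev r @ [y])" by simp
    moreover have "b \<in> B" "set (rev r) \<subseteq> D - X" using W unfolding W_def by auto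
    ultimately show ?thesis using C_step Z by blast
  qed
  have CD: "C A \<subseteq> D" "C B \<subseteq> D" by (auto simp: C_def)
  have "C A \<inter> C B = {}"
  proof (rule ccontr)
    assume "C A \<inter> C B \<noteq> {}"
    then obtain v a p b r where v: "v \<in> D - X" "a \<in> A" "b \<in> B" "set p \<subseteq> D - X" "set r \<subseteq> D - X"
      "successively E (a # p @ [v])" "successively E (b # r @ [v])"
      unfolding C_def by blast
    have "successively E (rev (b # r @ [v]))"
      using v by (simp only: successively_rev_sym[OF sym])
    then have "successively E (v # rev r @ [b])" by simp
    then have "successively E (a # (p @ v # rev r) @ [b])"
      using v(6) by (auto simp: successively_append_iff successively_Cons hd_append)
    moreover have "set (p @ v # rev r) \<subseteq> D - X" using v by auto
    ultimately show False using sep[of a b "p @ v # rev r"] v by blast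
  qed
  moreover have "linkage E A (C A - Z) Z"
    unfolding linkage_def using fin Z con Zcon ne adj lA disj CD by (intro conjI allI impI) blast+
  moreover have "linkage E Z (C B - Z) B"
    unfolding linkage_def
    using fin Z con Zcon ne adj disj CD linked_sym[OF symp_delete_edges[OF sym] lB]
    by (intro conjI allI impI) blast+
  ultimately show ?thesis using Z CD
    by (intro exI[of _ Z] exI[of _ "C A - Z"] exI[of _ "C B - Z"] conjI) auto
qed

section \<open>Half Farey graphs along the Stern--Brocot tree\<close>

type_synonym 'a triple = "'a set \<times> 'a set \<times> 'a set"

text \<open>The slope \<open>p / d\<close> in lowest terms is located in the Stern--Brocot tree by the subtractive
  Euclidean algorithm: slope 0 is the first and slope \<open>1 / 0\<close> the last component of the state.\<close>
function branch :: "('a triple \<Rightarrow> 'a triple) \<Rightarrow> ('a triple \<Rightarrow> 'a triple) \<Rightarrow> 'a triple \<Rightarrow> nat \<Rightarrow> nat \<Rightarrow> 'a set" where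
  "branch lft rgt s p d =
     (if p = 0 then fst s else if d = 0 then snd (snd s)
      else if p \<le> d then branch lft rgt (lft s) p (d - p) else branch lft rgt (rgt s) (p - d) d)"
  by pat_completeness auto
termination by (relation "measure (\<lambda>(lft, rgt, s, p, d). p + d)") auto

declare branch.simps [simp del]

text \<open>\<open>lft\<close> and \<open>rgt\<close> play the role of choice functions for the
  splitting lemma. They share the middle set \<open>Z\<close>, which is the branch set of the
  mediant.\<close>

locale splitting =
  fixes E :: "'a \<Rightarrow> 'a \<Rightarrow> bool" and good :: "'a triple \<Rightarrow> bool"
    and lft rgt :: "'a triple \<Rightarrow> 'a triple"
  assumes good_linkage: "good (A, D, B) \<Longrightarrow> linkage E A D B"
    and split: "good (A, D, B) \<Longrightarrow> \<exists>Z D1 D2. lft (A, D, B) = (A, D1, Z) \<and> rgt (A, D, B) = (Z, D2, B) \<and>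
      good (A, D1, Z) \<and> good (Z, D2, B) \<and> Z \<subseteq> D \<and> D1 \<subseteq> D \<and> D2 \<subseteq> D \<and> D1 \<inter> D2 = {}"
begin

abbreviation "br \<equiv> branch lft rgt"

lemma br_0 [simp]: "br (A, D, B) 0 d = A"
  by (simp add: branch.simps)

lemma br_inf [simp]: "p > 0 \<Longrightarrow> br (A, D, B) p 0 = B"
  by (simp add: branch.simps)

lemma br_left:
  assumes "good s" "p \<le> d" "d > 0"
  shows "br s p d = br (lft s) p (d - p)"
proof -
  obtain A D B where [simp]: "s = (A, D, B)" by (cases s)
  show ?thesis using split[of A D B] assms by (cases "p = 0") (auto simp: branch.simps[of _ _ _ p d])
qed

text \<open>\<open>br_left\<close> and \<open>br_right\<close> both cover \<open>p = d\<close>: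
  slope 1 is the mediant \<open>Z\<close>, the last component on the left and the first on the
  right.\<close>

lemma br_right:
  assumes "good s" "p \<ge> d" "p > 0"
  shows "br s p d = br (rgt s) (p - d) d"
proof -
  obtain A D B where [simp]: "s = (A, D, B)" by (cases s)
  obtain Z D1 D2 where "lft s = (A, D1, Z)" "rgt s = (Z, D2, B)" using split[of A D B] assms by auto
  then show ?thesis using assms
    by (cases "d = 0"; cases "p = d")
      (auto simp: branch.simps[of _ _ _ p d] branch.simps[of _ _ _ d d])
qed

lemma br_basic:
  assumes "good (A, D, B)" "coprime p d"
  shows "finite (br (A, D, B) p d) \<and> br (A, D, B) p d \<noteq> {} \<and> connected_set E (br (A, D, B) p d) \<and>
    (p > 0 \<longrightarrow> d > 0 \<longrightarrow> br (A, D, B) p d \<subseteq> D)"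
  using assms
proof (induction "p + d" arbitrary: A D B p d rule: less_induct)
  case less
  obtain Z D1 D2 where sp: "lft (A, D, B) = (A, D1, Z)" "rgt (A, D, B) = (Z, D2, B)"
      "good (A, D1, Z)" "good (Z, D2, B)" "Z \<subseteq> D" "D1 \<subseteq> D" "D2 \<subseteq> D"
    using split[OF less.prems(1)] by blast
  note lk = good_linkage[OF less.prems(1), unfolded linkage_def]
  consider "p = 0" | "d = 0" "p > 0" | "p > 0" "p \<le> d" | "d > 0" "d < p" by linarith
  then show ?case
  proof cases
    case 3
    have "coprime p (d - p)" using less.prems(2) 3
      by (metis coprime_iff_gcd_eq_1 gcd.commute gcd_diff1_nat)
    \<comment> \<open>At \<open>p = d\<close> the descent stops in \<open>Z\<close>, which lies in
      \<open>D\<close> but not in \<open>D1\<close>.\<close>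
    moreover have "d - p = 0 \<Longrightarrow> br (A, D1, Z) p (d - p) \<subseteq> D" using 3 sp by simp
    ultimately show ?thesis
      using less.hyps[of p "d - p" A D1 Z] 3 sp br_left[OF less.prems(1), of p d] by auto
  next
    case 4
    have "coprime (p - d) d" using less.prems(2) 4
      by (metis coprime_iff_gcd_eq_1 gcd_diff1_nat less_imp_le)
    then show ?thesis
      using less.hyps[of "p - d" d Z D2 B] 4 sp br_right[OF less.prems(1), of d p] by auto
  qed (use lk in auto)
qed

text \<open>Two slopes descend together while they lie on the same side of 1. When they part, their
  branch sets lie in \<open>Z \<union> D1\<close> and in \<open>D2\<close>, which are
  disjoint.\<close>

lemma br_disjoint:
  assumes "good (A, D, B)" "coprime p d" "coprime p' d'" "(p, d) \<noteq> (p', d')"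
  shows "br (A, D, B) p d \<inter> br (A, D, B) p' d' = {}"
  using assms
proof (induction "p + d" arbitrary: A D B p d p' d' rule: less_induct)
  case less
  obtain Z D1 D2 where sp: "lft (A, D, B) = (A, D1, Z)" "rgt (A, D, B) = (Z, D2, B)"
      "good (A, D1, Z)" "good (Z, D2, B)" "Z \<subseteq> D" "D1 \<subseteq> D" "D2 \<subseteq> D" "D1 \<inter> D2 = {}"
    using split[OF less.prems(1)] by blast
  have dj: "A \<inter> B = {}" "A \<inter> D = {}" "B \<inter> D = {}"
    using good_linkage[OF less.prems(1)] unfolding linkage_def by auto
  have zd: "Z \<inter> D1 = {}" "Z \<inter> D2 = {}"
    using good_linkage[OF sp(3)] good_linkage[OF sp(4)] unfolding linkage_def by auto
  have ends: "br (A, D, B) q e = A \<and> q = 0 \<and> e = 1 \<or> br (A, D, B) q e = B \<and> q = 1 \<and> e = 0 \<or>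
      br (A, D, B) q e \<subseteq> D \<and> q > 0 \<and> e > 0" if "coprime q e" for q e
    using br_basic[OF less.prems(1) that] that by (cases "q = 0"; cases "e = 0") auto
  have cop_l: "coprime q (e - q)" if "coprime q e" "q \<le> e" for q e :: nat
    using that by (metis coprime_iff_gcd_eq_1 gcd.commute gcd_diff1_nat)
  have cop_r: "coprime (q - e) e" if "coprime q e" "e < q" for q e :: nat
    using that by (metis coprime_iff_gcd_eq_1 gcd_diff1_nat less_imp_le)
  \<comment> \<open>Slope 1 is counted to the left, so \<open>Z\<close> occurs here and not in
    \<open>R\<close>.\<close>
  have L: "br (A, D, B) q e \<subseteq> Z \<union> D1" if "coprime q e" "q > 0" "q \<le> e" for q e
    using br_basic[OF sp(3) cop_l[OF that(1,3)]] br_left[OF less.prems(1), of q e] that sp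
    by (cases "q = e") auto
  have R: "br (A, D, B) q e \<subseteq> D2" if "coprime q e" "e > 0" "e < q" for q e
    using br_basic[OF sp(4) cop_r[OF that(1,3)]] br_right[OF less.prems(1), of e q] that sp by auto
  show ?case
  proof (cases "p = 0 \<or> d = 0 \<or> p' = 0 \<or> d' = 0")
    case True
    then show ?thesis using ends[OF less.prems(2)] ends[OF less.prems(3)] dj less.prems(4)
      by (elim disjE conjE) (simp_all, blast+)
  next
    case False
    consider "p \<le> d" "p' \<le> d'" | "p \<le> d" "d' < p'" | "d < p" "p' \<le> d'" | "d < p" "d' < p'"
      by linarith
    then show ?thesis
    proof cases
      case 1
      then have "(p, d - p) \<noteq> (p', d' - p')" using less.prems(4) by auto
      then have "br (A, D1, Z) p (d - p) \<inter> br (A, D1, Z) p' (d' - p') = {}"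
        using 1 False cop_l less.prems by (intro less.hyps sp) auto
      then show ?thesis
        using 1 False br_left[OF less.prems(1), of p d] br_left[OF less.prems(1), of p' d'] sp by simp
    next
      case 2
      then show ?thesis using L[OF less.prems(2)] R[OF less.prems(3)] False zd sp by fastforce
    next
      case 3
      then show ?thesis using R[OF less.prems(2)] L[OF less.prems(3)] False zd sp by fastforce
    next
      case 4
      then have "(p - d, d) \<noteq> (p' - d', d')" using less.prems(4) by auto
      then have "br (Z, D2, B) (p - d) d \<inter> br (Z, D2, B) (p' - d') d' = {}"
        using 4 False cop_r less.prems by (intro less.hyps sp) auto
      then show ?thesis
        using 4 False br_right[OF less.prems(1), of d p] br_right[OF less.prems(1), of d' p'] sp
          by simp
    qed
  qed
qed

text \<open>The hypothesis says that \<open>p / d\<close> and \<open>p' / d'\<close> are Farey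
  neighbours in increasing order. A subtractive step preserves the determinant, and neighbours lie
  weakly on one side of 1 until they are 0 and infinity, whose sets \<open>A\<close> and
  \<open>B\<close> are adjacent.\<close>

lemma br_adjacent:
  assumes "good (A, D, B)" "p' * d = p * d' + 1"
  shows "\<exists>x\<in>br (A, D, B) p d. \<exists>y\<in>br (A, D, B) p' d'. E x y"
  using assms
proof (induction "p + d + p' + d'" arbitrary: A D B p d p' d' rule: less_induct)
  case less
  obtain Z D1 D2 where sp: "lft (A, D, B) = (A, D1, Z)" "rgt (A, D, B) = (Z, D2, B)"
      "good (A, D1, Z)" "good (Z, D2, B)"
    using split[OF less.prems(1)] by blast
  have pos: "p' > 0" "d > 0" using less.prems(2) by (auto intro: gr0I)
  consider "p < d" "d' < p'" | "p \<le> d" "p' \<le> d'" | "d \<le> p" "d' \<le> p'" | "d < p" "p' < d'"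
    by linarith
  then show ?case
  proof cases
    case 1
    then obtain u v where uv: "d = Suc (p + u)" "p' = Suc (d' + v)"
      by (metis less_imp_Suc_add)
    \<comment> \<open>Here 1 lies strictly between the slopes; after expansion a sum of non-negative
      terms, among them \<open>p\<close> and \<open>d'\<close>, equals 0.\<close>
    have "p = 0 \<and> d' = 0"
      using less.prems(2) by (simp add: uv algebra_simps)
    then have "p = 0" "d' = 0" by auto
    then show ?thesis
      using good_linkage[OF less.prems(1)] pos by (simp add: linkage_def)
  next
    case 2
    then obtain u v where uv: "d = p + u" "d' = p' + v" by (metis le_iff_add)
    have "\<exists>x\<in>br (A, D1, Z) p (d - p). \<exists>y\<in>br (A, D1, Z) p' (d' - p'). E x y"
      using less.prems(2) pos 2 by (intro less.hyps sp) (auto simp: uv algebra_simps)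
    then show ?thesis
      using 2 pos br_left[OF less.prems(1), of p d] br_left[OF less.prems(1), of p' d'] sp by simp
  next
    case 3
    then obtain u v where uv: "p = d + u" "p' = d' + v" by (metis le_iff_add)
    have "\<exists>x\<in>br (Z, D2, B) (p - d) d. \<exists>y\<in>br (Z, D2, B) (p' - d') d'. E x y"
      using less.prems(2) pos 3 by (intro less.hyps sp) (auto simp: uv algebra_simps)
    then show ?thesis
      using 3 pos br_right[OF less.prems(1), of d p] br_right[OF less.prems(1), of d' p'] sp by simp
  next
    case 4
    then have "p' * d \<le> d' * p" by (intro mult_le_mono) auto
    then show ?thesis using less.prems(2) by (simp add: mult.commute)
  qed
qed

end

text \<open>Branch sets for the Farey graph on the slopes from 0 to infinity, indexed by numerator
  and denominator. The last clause lists each edge once, from the smaller slope to the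
  larger.\<close>

definition half_farey_model ::
    "('a \<Rightarrow> 'a \<Rightarrow> bool) \<Rightarrow> 'a set \<Rightarrow> 'a set \<Rightarrow> 'a set \<Rightarrow> (nat \<Rightarrow> nat \<Rightarrow> 'a set) \<Rightarrow> bool" where
  "half_farey_model E A D B f \<longleftrightarrow> f 0 1 = A \<and> f 1 0 = B \<and>
    (\<forall>p d. coprime p d \<longrightarrow> finite (f p d) \<and> f p d \<noteq> {} \<and> connected_set E (f p d)) \<and>
    (\<forall>p d. coprime p d \<longrightarrow> p > 0 \<longrightarrow> d > 0 \<longrightarrow> f p d \<subseteq> D) \<and>
    (\<forall>p d p' d'. coprime p d \<longrightarrow> coprime p' d' \<longrightarrow> (p, d) \<noteq> (p', d') \<longrightarrow> f p d \<inter> f p' d' = {}) \<and>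
    (\<forall>p d p' d'. p' * d = p * d' + 1 \<longrightarrow> (\<exists>x\<in>f p d. \<exists>y\<in>f p' d'. E x y))"

lemma half_farey_model_exists:
  assumes sym: "symp E" and lk: "linkage E A D B" and V: "A \<union> D \<union> B \<subseteq> V"
    and no: "\<And>a b. a \<in> V \<Longrightarrow> b \<in> V \<Longrightarrow> a \<noteq> b \<Longrightarrow> \<not> infinitely_many_independent_paths E a b"
  shows "\<exists>f. half_farey_model E A D B f"
proof -
  \<comment> \<open>Staying inside \<open>V\<close> keeps \<open>no\<close> applicable to every
    later pair of branch sets.\<close>
  define good where "good = (\<lambda>(A, D, B). linkage E A D B \<and> A \<union> D \<union> B \<subseteq> V)"
  have ex: "\<exists>Z D1 D2. good (A, D, B) \<longrightarrow> good (A, D1, Z) \<and> good (Z, D2, B) \<and>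
      Z \<subseteq> D \<and> D1 \<subseteq> D \<and> D2 \<subseteq> D \<and> D1 \<inter> D2 = {}" for A D B
  proof (cases "good (A, D, B)")
    case True
    then have g: "linkage E A D B" "A \<union> D \<union> B \<subseteq> V" by (auto simp: good_def)
    then have "A \<inter> B = {}" by (simp add: linkage_def)
    then have "\<not> infinitely_many_independent_paths E a b" if "a \<in> A" "b \<in> B" for a b
      using that g by (intro no) auto
    from linkage_split[OF sym g(1) this] obtain Z D1 D2 where
      "linkage E A D1 Z" "linkage E Z D2 B" "Z \<subseteq> D" "D1 \<subseteq> D" "D2 \<subseteq> D" "D1 \<inter> D2 = {}" by blast
    with g(2) show ?thesis
      by (intro exI[of _ Z] exI[of _ D1] exI[of _ D2]) (auto simp: good_def)
  qed auto
  then obtain Z D1 D2 where t: "\<And>A D B. good (A, D, B) \<Longrightarrow>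
      good (A, D1 A D B, Z A D B) \<and> good (Z A D B, D2 A D B, B) \<and>
      Z A D B \<subseteq> D \<and> D1 A D B \<subseteq> D \<and> D2 A D B \<subseteq> D \<and> D1 A D B \<inter> D2 A D B = {}"
    by metis
  define lft where "lft = (\<lambda>(A, D, B). (A, D1 A D B, Z A D B))"
  define rgt where "rgt = (\<lambda>(A, D, B). (Z A D B, D2 A D B, B))"
  interpret splitting E good lft rgt
  proof
    fix A D B assume g: "good (A, D, B)"
    then show "linkage E A D B" by (simp add: good_def)
    show "\<exists>Z D1 D2. lft (A, D, B) = (A, D1, Z) \<and> rgt (A, D, B) = (Z, D2, B) \<and>
      good (A, D1, Z) \<and> good (Z, D2, B) \<and> Z \<subseteq> D \<and> D1 \<subseteq> D \<and> D2 \<subseteq> D \<and> D1 \<inter> D2 = {}"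
      using t[OF g] by (simp add: lft_def rgt_def)
  qed
  have "good (A, D, B)" using lk V by (simp add: good_def)
  then show ?thesis
    unfolding half_farey_model_def
    by (intro exI[of _ "br (A, D, B)"] conjI allI impI)
       (simp_all add: br_basic br_disjoint br_adjacent)
qed

text \<open>Any edge serves: its two ends are the first branch sets and all other vertices form the
  reservoir.\<close>

lemma pi_graph_linkage:
  assumes "pi_graph V E"
  shows "\<exists>A D B. linkage E A D B \<and> A \<union> D \<union> B \<subseteq> V"
proof -
  have g: "graph V E" and con: "\<And>S. finite S \<Longrightarrow> S \<subseteq> {{x, y} | x y. E x y}
      \<Longrightarrow> connected_set (delete_edges E S) V"
    using assms unfolding pi_graph_def inf_edge_connected_def by auto
  obtain x y where xy: "x \<in> V" "y \<in> V" "x \<noteq> y"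
    using assms unfolding pi_graph_def inf_edge_connected_def by blast
  have "connected_set (delete_edges E {}) V" by (rule con) auto
  then have "(\<lambda>a b. delete_edges E {} a b \<and> a \<in> V \<and> b \<in> V)\<^sup>*\<^sup>* x y"
    using xy by (auto simp: connected_set_def)
  then obtain v where v: "E x v"
    using xy(3) by (cases rule: converse_rtranclpE) (auto simp: delete_edges_def)
  have vV: "v \<in> V" "x \<noteq> v" using g v by (auto simp: graph_def)
  have "linked (delete_edges E S) {x} (V - {x, v}) {v}" if "finite S" for S
  proof -
    \<comment> \<open>The connectivity hypothesis concerns sets of edges; discarding the other
      members of \<open>S\<close> leaves the deletion unchanged.\<close>
    let ?S = "S \<inter> {{x, y} | x y. E x y}"
    have del: "delete_edges E ?S = delete_edges E S" by (auto simp: delete_edges_def fun_eq_iff)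
    have "connected_set (delete_edges E ?S) V" using that by (intro con) auto
    then have "(\<lambda>a b. delete_edges E S a b \<and> a \<in> V \<and> b \<in> V)\<^sup>*\<^sup>* x v"
      using xy vV unfolding del by (auto simp: connected_set_def)
    from rtranclp_distinct_walk[OF this] obtain xs where xs: "xs \<noteq> []" "distinct xs" "hd xs = x"
      "last xs = v" "successively (\<lambda>a b. delete_edges E S a b \<and> a \<in> V \<and> b \<in> V) xs" by blast
    have suc: "successively (delete_edges E S) xs"
      by (rule successively_mono[OF xs(5)]) simp
    obtain ys where ys: "xs = x # ys" using xs by (cases xs) auto
    then obtain p where p: "ys = p @ [v]" using xs vV by (cases ys rule: rev_cases) auto
    have "set xs \<subseteq> V"
      using xs(5) by (rule walk_set_subset) (use xs xy in auto)
    then have "set p \<subseteq> V - {x, v}" using xs(2) by (auto simp: ys p)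
    then show ?thesis using suc unfolding linked_def ys p by auto
  qed
  then have "linkage E {x} (V - {x, v}) {v}"
    using v vV by (auto simp: linkage_def connected_set_def)
  then show ?thesis using xy vV by blast
qed

section \<open>The Farey graph\<close>

definition det :: "int \<times> int \<Rightarrow> int \<times> int \<Rightarrow> int" where
  "det u v = fst u * snd v - snd u * fst v"

lemma farey_iff_det: "farey x y \<longleftrightarrow> \<bar>det (frac x) (frac y)\<bar> = 1"
  by (simp add: farey_def det_def split: prod.splits)

lemma farey_sym: "symp farey"
  by (rule sympI) (simp add: farey_iff_det det_def abs_if algebra_simps split: if_splits)

lemma frac_coprime: "coprime (fst (frac x)) (snd (frac x))"
  by (cases x) (auto intro!: quotient_of_coprime simp: prod_eq_iff)

lemma frac_denom_nonneg: "snd (frac x) \<ge> 0"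
  using quotient_of_denom_pos' by (cases x) (auto intro: less_imp_le)


lemma coprime_if_det_eq_1:
  assumes "\<bar>det u v\<bar> = 1"
  shows "coprime (fst v) (snd v)"
proof (rule coprimeI)
  fix g assume "g dvd fst v" "g dvd snd v"
  then have "g dvd det u v" by (simp add: det_def)
  then have "g dvd \<bar>det u v\<bar>" by simp
  then show "is_unit g" by (simp add: assms)
qed

lemma det_frac_eq_0_iff: "det (frac x) (frac y) = 0 \<longleftrightarrow> x = y"
proof
  assume z: "det (frac x) (frac y) = 0"
  obtain a b c d where fr: "frac x = (a, b)" "frac y = (c, d)" by (metis surj_pair)
  have eq: "a * d = b * c" using z by (simp add: det_def fr)
  have cop: "coprime a b" "coprime c d" and pos: "b \<ge> 0" "d \<ge> 0"
    using frac_coprime[of x] frac_coprime[of y] frac_denom_nonneg[of x] frac_denom_nonneg[of y]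
    by (simp_all add: fr)
  have "b dvd d" using cop eq by (metis coprime_commute coprime_dvd_mult_right_iff dvd_triv_left)
  moreover have "d dvd b"
    using cop eq by (metis coprime_commute coprime_dvd_mult_left_iff dvd_triv_right)
  ultimately have bd: "b = d" using pos by (simp add: zdvd_antisym_nonneg)
  show "x = y"
  proof (cases x)
    case None
    then have "b = 0" using fr by simp
    then have "y = None"
      using fr bd quotient_of_denom_pos' by (cases y) (auto, metis less_irrefl snd_conv)
    then show ?thesis using None by simp
  next
    case (Some q)
    then have "b > 0" using fr quotient_of_denom_pos by simp
    then obtain r where "y = Some r" using fr bd by (cases y) auto
    moreover have "a = c" using eq bd \<open>b > 0\<close> by simp
    ultimately show ?thesis using Some fr bd quotient_of_inject[of q] by simp
  qed
qed (simp add: det_def)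

definition vertex :: "int \<times> int \<Rightarrow> rat option" where
  "vertex v = (if snd v = 0 then None else Some (Fract (fst v) (snd v)))"

text \<open>Lowest terms are unique up to sign, and \<open>frac\<close> chooses the sign with
  non-negative denominator, and 1/0 for infinity.\<close>

lemma frac_vertex:
  assumes "coprime a b"
  shows "frac (vertex (a, b)) = (a, b) \<or> frac (vertex (a, b)) = (- a, - b)"
proof (cases b "0 :: int" rule: linorder_cases)
  case less
  then have "Fract a b = Fract (- a) (- b)" by simp
  then have "quotient_of (Fract a b) = (- a, - b)"
    using less assms by (simp only: quotient_of_Fract) (simp add: normalize_stable)
  then show ?thesis using less by (simp add: vertex_def)
next
  case equal
  then have "\<bar>a\<bar> = 1" using assms by simp
  then show ?thesis using equal by (auto simp: vertex_def abs_if split: if_splits)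
next
  case greater
  then show ?thesis using assms by (simp add: vertex_def quotient_of_Fract normalize_stable)
qed

lemma farey_vertex:
  assumes "\<bar>det (frac x) v\<bar> = 1"
  shows "farey x (vertex v)"
proof -
  have "frac (vertex v) = v \<or> frac (vertex v) = (- fst v, - snd v)"
    using frac_vertex[OF coprime_if_det_eq_1[OF assms]] by simp
  then show ?thesis using assms by (auto simp: farey_iff_det det_def abs_if split: if_splits)
qed

section \<open>Infinite edge-connectivity of the Farey graph\<close>

definition height :: "rat option \<Rightarrow> nat" where
  "height x = nat (\<bar>fst (frac x)\<bar> + \<bar>snd (frac x)\<bar>)"

lemma height_pos: "height x > 0"
proof -
  have "fst (frac x) \<noteq> 0 \<or> snd (frac x) \<noteq> 0" using frac_coprime[of x] by auto
  then show ?thesis by (auto simp: height_def)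
qed

text \<open>Sum and difference of the two integer vectors give the common neighbours; the sign
  \<open>s\<close> is chosen so that neither coordinate cancels. The height then rises above both
  ends, which drives the detour argument.\<close>

lemma farey_mediant:
  assumes "farey x y"
  shows "\<exists>z. farey x z \<and> farey z y \<and> height z = height x + height y"
proof -
  obtain a b c d where fr: "frac x = (a, b)" "frac y = (c, d)" by (metis surj_pair)
  have dt: "\<bar>a * d - b * c\<bar> = 1" using assms by (simp add: farey_iff_det det_def fr)
  have pos: "b \<ge> 0" "d \<ge> 0"
    using frac_denom_nonneg[of x] frac_denom_nonneg[of y] by (simp_all add: fr)
  have "\<exists>s. (s = 1 \<or> s = -1) \<and> \<bar>a + s * c\<bar> = \<bar>a\<bar> + \<bar>c\<bar> \<and> \<bar>b + s * d\<bar> = \<bar>b\<bar> + \<bar>d\<bar>"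
  proof (cases "a \<ge> 0 \<and> c \<ge> 0 \<or> a \<le> 0 \<and> c \<le> 0")
    case True
    then show ?thesis using pos by (intro exI[of _ 1]) auto
  next
    case False
    \<comment> \<open>With numerators of strictly opposite sign and positive denominators the
      determinant would have absolute value at least 2. So one end is infinity and the difference
      works.\<close>
    have "b = 0 \<or> d = 0"
    proof (rule ccontr)
      assume "\<not> ?thesis"
      then have bd: "b \<ge> 1" "d \<ge> 1" using pos by auto
      consider "a > 0" "c < 0" | "a < 0" "c > 0" using False by linarith
      then show False
      proof cases
        case 1
        then have "a * d \<ge> 1" "b * (- c) \<ge> 1"
          using bd by (simp_all add: int_one_le_iff_zero_less mult_pos_neg)
        then show False using dt unfolding mult_minus_right mult_minus_left by linarith
      next
        case 2
        then have "(- a) * d \<ge> 1" "b * c \<ge> 1"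
          using bd by (simp_all add: int_one_le_iff_zero_less mult_neg_pos)
        then show False using dt unfolding mult_minus_right mult_minus_left by linarith
      qed
    qed
    then show ?thesis using False pos by (intro exI[of _ "-1"]) auto
  qed
  then obtain s where s: "s = 1 \<or> s = -1" "\<bar>a + s * c\<bar> = \<bar>a\<bar> + \<bar>c\<bar>" "\<bar>b + s * d\<bar> = \<bar>b\<bar> + \<bar>d\<bar>"
    by blast
  define v where "v = (a + s * c, b + s * d)"
  have "\<bar>det (a, b) v\<bar> = 1" "\<bar>det (c, d) v\<bar> = 1"
  proof -
    have "det (a, b) v = s * (a * d - b * c)" "det (c, d) v = - (a * d - b * c)"
      by (simp_all add: det_def v_def algebra_simps)
    then show "\<bar>det (a, b) v\<bar> = 1" "\<bar>det (c, d) v\<bar> = 1" using dt s(1) by auto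
  qed
  then have xz: "farey x (vertex v)" and "farey y (vertex v)" and cop: "coprime (fst v) (snd v)"
    using fr coprime_if_det_eq_1 by (auto intro!: farey_vertex)
  then have "farey (vertex v) y" using farey_sym by (meson sympD)
  moreover have "height (vertex v) = height x + height y"
  proof -
    have "\<bar>fst (frac (vertex v))\<bar> = \<bar>a + s * c\<bar>" "\<bar>snd (frac (vertex v))\<bar> = \<bar>b + s * d\<bar>"
      using frac_vertex[OF cop] by (auto simp: v_def)
    then show ?thesis by (simp add: height_def fr s(2,3) nat_add_distrib)
  qed
  ultimately show ?thesis using xz by blast
qed

text \<open>Reducing a Bezout coefficient modulo the denominator gives a neighbour of smaller
  denominator, which drives the descent to infinity. Such a \<open>w\<close> also serves as second
  basis vector for the coordinates below.\<close>

lemma frac_bezout: "\<exists>w. det (frac x) w = 1 \<and> (snd (frac x) > 0 \<longrightarrow> 0 \<le> snd w \<and> snd w < snd (frac x))"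
proof -
  obtain a b where fr: "frac x = (a, b)" by (metis surj_pair)
  have b: "b \<ge> 0" using frac_denom_nonneg[of x] by (simp add: fr)
  have "coprime a b" using frac_coprime[of x] by (simp add: fr)
  then obtain u v where uv: "u * a + v * b = 1" by (metis bezout_int coprime_imp_gcd_eq_1)
  have "u mod b = u - b * (u div b)" by (rule minus_mult_div_eq_mod[symmetric])
  then have "a * (u mod b) - b * (- (v + a * (u div b))) = 1"
    using uv by (simp only:) (simp add: algebra_simps)
  then show ?thesis
    using b by (intro exI[of _ "(- (v + a * (u div b)), u mod b)"]) (auto simp: det_def fr)
qed

lemma farey_connected_to_infinity: "farey\<^sup>*\<^sup>* x None"
proof (induction "nat (snd (frac x))" arbitrary: x rule: less_induct)
  case less
  show ?case
  proof (cases x)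
    case (Some q)
    then have pos: "snd (frac x) > 0" using quotient_of_denom_pos' by simp
    obtain w where w: "det (frac x) w = 1" "0 \<le> snd w" "snd w < snd (frac x)"
      using frac_bezout[of x] pos by blast
    have "coprime (fst w) (snd w)" using w coprime_if_det_eq_1[of "frac x" w] by simp
    from frac_vertex[OF this] have "snd (frac (vertex w)) \<le> snd w"
      using w by auto
    then have "farey\<^sup>*\<^sup>* (vertex w) None" using w pos by (intro less) auto
    moreover have "farey x (vertex w)" using w by (intro farey_vertex) simp
    ultimately show ?thesis by (rule converse_rtranclp_into_rtranclp[rotated])
  qed simp
qed

lemma farey_inf_edge_connected: "inf_edge_connected UNIV farey"
proof -
  have irr: "\<not> farey x x" for x by (simp add: farey_iff_det det_def)
  have "connected_set (delete_edges farey S) UNIV"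
    if S: "finite S" "S \<subseteq> {{x, y} | x y. farey x y}" for S
  proof -
    let ?R = "delete_edges farey S"
    have "finite (\<Union>S)" using S by (intro finite_Union) auto
    then have "finite (height ` \<Union>S)" by simp
    then obtain M where M: "\<And>x. x \<in> \<Union>S \<Longrightarrow> height x \<le> M"
      by (metis finite_nat_set_iff_bounded_le imageI)
    have edge: "?R\<^sup>*\<^sup>* x y" if "farey x y" for x y
      using that
    \<comment> \<open>\<open>M\<close> bounds the heights of all ends of deleted edges, so only
      edges of height sum at most \<open>2 * M\<close> need a detour. Passing to the mediant
      strictly increases this sum, and the summand 1 keeps the measure positive until then.\<close>
    proof (induction "2 * M + 1 - (height x + height y)" arbitrary: x y rule: less_induct)
      case less
      show ?case
      proof (cases "{x, y} \<in> S")
        case True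
        then have "height x + height y \<le> 2 * M"
          using add_mono[OF M[OF UnionI, of "{x, y}" x] M[OF UnionI, of "{x, y}" y]] by simp
        moreover obtain z where z: "farey x z" "farey z y" "height z = height x + height y"
          using farey_mediant[OF less.prems] by blast
        ultimately have "?R\<^sup>*\<^sup>* x z" "?R\<^sup>*\<^sup>* z y"
          using height_pos[of x] height_pos[of y] by (auto intro!: less.hyps)
        then show ?thesis by (rule rtranclp_trans)
      next
        case False
        then show ?thesis using less.prems by (simp add: delete_edges_def r_into_rtranclp)
      qed
    qed
    have to_inf: "?R\<^sup>*\<^sup>* x None" for x
      using farey_connected_to_infinity[of x]
      by (induction rule: converse_rtranclp_induct) (auto dest: edge intro: rtranclp_trans)
    have "symp ?R\<^sup>*\<^sup>*"
      using farey_sym by (intro symp_rtranclp) (auto simp: symp_def delete_edges_def insert_commute)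
    then have "?R\<^sup>*\<^sup>* x y" for x y
      using to_inf[of x] to_inf[of y] by (meson rtranclp_trans sympD)
    then show ?thesis by (simp add: connected_set_def)
  qed
  moreover have "\<exists>x\<in>UNIV. \<exists>y\<in>UNIV. x \<noteq> (y :: rat option)" by auto
  ultimately show ?thesis
    using farey_sym irr by (auto simp: inf_edge_connected_def graph_def dest: sympD)
qed

section \<open>Finite vertex separators in the Farey graph\<close>

text \<open>Relative to the basis \<open>(u, w)\<close> of the integer lattice, a vertex \<open>x \<noteq> u\<close> has slope
  \<open>coordn u w x / coordd u w x\<close>; thus \<open>u\<close> is moved to infinity and its neighbours to the integers.\<close>
definition coordn :: "rat option \<Rightarrow> int \<times> int \<Rightarrow> rat option \<Rightarrow> int" where
  "coordn u w x = sgn (det (frac u) (frac x)) * det (frac x) w"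

definition coordd :: "rat option \<Rightarrow> rat option \<Rightarrow> int" where
  "coordd u x = \<bar>det (frac u) (frac x)\<bar>"

lemma coordd_pos: "x \<noteq> u \<Longrightarrow> coordd u x > 0"
  using det_frac_eq_0_iff[of u x] by (simp add: coordd_def)

text \<open>The basis has determinant 1, so passing to coordinates preserves determinants up to the
  signs that make denominators positive.\<close>

lemma coord_det:
  assumes w: "det (frac u) w = 1" and "x \<noteq> u" "y \<noteq> u"
  shows "\<bar>coordn u w x * coordd u y - coordn u w y * coordd u x\<bar> = \<bar>det (frac x) (frac y)\<bar>"
proof -
  let ?d = "\<lambda>x. det (frac u) (frac x)"
  \<comment> \<open>This is the three-term Pluecker relation for \<open>u\<close>, \<open>w\<close>,
    \<open>x\<close> and \<open>y\<close>.\<close>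
  have "det (frac x) w * ?d y - det (frac y) w * ?d x = det (frac x) (frac y) * det (frac u) w"
    by (simp add: det_def algebra_simps)
  then have id: "det (frac x) w * ?d y - det (frac y) w * ?d x = det (frac x) (frac y)"
    using w by simp
  have "coordn u w x * coordd u y - coordn u w y * coordd u x
      = sgn (?d x) * sgn (?d y) * (det (frac x) w * ?d y - det (frac y) w * ?d x)"
    by (simp add: coordn_def coordd_def abs_sgn algebra_simps)
  moreover have "\<bar>sgn (?d x)\<bar> = 1" "\<bar>sgn (?d y)\<bar> = 1"
    using assms det_frac_eq_0_iff[of u x] det_frac_eq_0_iff[of u y] by (auto simp: abs_sgn_eq)
  ultimately show ?thesis using id by (simp add: abs_mult)
qed

text \<open>An edge crossing the integer \<open>c\<close> would leave, by integrality, a gap on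
  either side of \<open>c\<close> and so a determinant of at least the sum of two positive
  denominators, hence at least 2.\<close>

lemma farey_no_crossing:
  assumes w: "det (frac u) w = 1" and "x \<noteq> u" "y \<noteq> u" "farey x y"
    and "coordn u w x > c * coordd u x"
  shows "coordn u w y \<ge> c * coordd u y"
proof (rule ccontr)
  assume "\<not> ?thesis"
  then have y: "coordn u w y \<le> c * coordd u y - 1" by simp
  have pos: "coordd u x \<ge> 1" "coordd u y \<ge> 1"
    using coordd_pos[of x u] coordd_pos[of y u] assms by auto
  have "coordn u w x * coordd u y \<ge> (c * coordd u x + 1) * coordd u y"
    using assms pos by (intro mult_right_mono) auto
  moreover have "coordn u w y * coordd u x \<le> (c * coordd u y - 1) * coordd u x"
    using y pos by (intro mult_right_mono) auto
  ultimately have "coordn u w x * coordd u y - coordn u w y * coordd u x \<ge> coordd u y + coordd u x"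
    by (simp add: algebra_simps)
  then show False using coord_det[OF assms(1-3)] assms(4) pos by (simp add: farey_iff_det)
qed

lemma farey_walk_meets_integer:
  assumes w: "det (frac u) w = 1" and "u \<notin> set xs" "xs \<noteq> []" "successively farey xs"
    and "coordn u w (hd xs) > c * coordd u (hd xs)" "coordn u w (last xs) < c * coordd u (last xs)"
  shows "\<exists>z\<in>set xs. coordn u w z = c * coordd u z"
  using assms(2-)
proof (induction xs rule: induct_list012)
  case (3 x y zs)
  then have "coordn u w y \<ge> c * coordd u y"
    by (intro farey_no_crossing[OF w, of x y]) auto
  then consider "coordn u w y = c * coordd u y" | "coordn u w y > c * coordd u y" by linarith
  then show ?case using 3 by cases auto
qed auto

lemma farey_finite_separator:
  assumes "u \<noteq> v"
  shows "\<exists>X. finite X \<and> (\<forall>p. is_path farey u v p \<longrightarrow> p \<noteq> [u, v] \<longrightarrow> inner_vertices p \<inter> X \<noteq> {})"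
proof -
  obtain w where w: "det (frac u) w = 1" using frac_bezout by blast
  let ?n = "coordn u w" and ?d = "coordd u"
  define X where "X c = {x. x \<noteq> u \<and> ?n x = c * ?d x}" for c
  \<comment> \<open>Two vertices of the same slope have determinant 0, so \<open>X c\<close> has at
    most one element.\<close>
  have "x = y" if "x \<in> X c" "y \<in> X c" for x y c
    using coord_det[OF w, of x y] that det_frac_eq_0_iff[of x y] by (simp add: X_def)
  then have "X c \<subseteq> {SOME x. x \<in> X c}" for c by (metis singletonI someI subsetI)
  then have fin: "finite (X c)" for c by (meson finite.emptyI finite.insertI finite_subset)
  \<comment> \<open>\<open>k\<close> is the floor of the slope of \<open>v\<close>. The slope may
    equal \<open>k\<close>, and a vertex cannot separate itself, so the lower barrier is
    \<open>k - 1\<close>.\<close>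
  define k where "k = ?n v div ?d v"
  have "?d v > 0" using coordd_pos assms by auto
  moreover have "?n v = k * ?d v + ?n v mod ?d v" unfolding k_def by (rule div_mult_mod_eq[symmetric])
  ultimately have v: "k * ?d v \<le> ?n v" "?n v < (k + 1) * ?d v"
    using pos_mod_sign[OF \<open>?d v > 0\<close>, of "?n v"] pos_mod_bound[OF \<open>?d v > 0\<close>, of "?n v"]
    unfolding distrib_right mult_1 by linarith+
  then have v': "?n v > (k - 1) * ?d v" using \<open>?d v > 0\<close> by (simp add: algebra_simps)
  have "inner_vertices p \<inter> (X (k - 1) \<union> X k \<union> X (k + 1)) \<noteq> {}"
    if p: "is_path farey u v p" "p \<noteq> [u, v]" for p
  proof -
    have "p \<noteq> []" "hd p = u" "last p = v" using p by (auto simp: is_path_def)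
    then obtain q where q: "p = u # q" "q \<noteq> []" using assms by (metis last.simps list.collapse)
    then have qs: "u \<notin> set q" "distinct q" "last q = v" "successively farey q" "farey u (hd q)"
      using p by (auto simp: is_path_def successively_Cons)
    obtain r where r: "q = r @ [v]" using q qs(3) by (cases q rule: rev_cases) auto
    have inner: "inner_vertices p = set q - {v}"
      using qs(2) by (auto simp: inner_vertices_def q r)
    have "hd q \<noteq> v" using p(2) q(1) qs(2) by (cases r) (auto simp: r)
    have "hd q \<noteq> u" using q qs by (metis hd_in_set)
    \<comment> \<open>The path leaves \<open>u\<close> to a neighbour, whose slope is an integer: it
      is one of the three barriers itself, or lies above \<open>k + 1\<close> or below
      \<open>k - 1\<close> and must still pass that barrier to reach \<open>v\<close>.\<close>
    have d1: "?d (hd q) = 1" using qs(5) by (simp add: coordd_def farey_iff_det)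
    consider "?n (hd q) \<in> {k - 1, k, k + 1}" | "?n (hd q) > k + 1" | "?n (hd q) < k - 1" by force
    then show ?thesis
    proof cases
      case 1
      then have "hd q \<in> X (k - 1) \<union> X k \<union> X (k + 1)" using \<open>hd q \<noteq> u\<close> d1 by (auto simp: X_def)
      then show ?thesis using \<open>hd q \<noteq> v\<close> hd_in_set[OF q(2)] unfolding inner by blast
    next
      case 2
      then obtain z where "z \<in> set q" "?n z = (k + 1) * ?d z"
        using farey_walk_meets_integer[OF w qs(1) q(2) qs(4), of "k + 1"] qs(3) v d1 by auto
      then have "z \<in> X (k + 1)" "z \<noteq> v" using qs(1) v by (auto simp: X_def)
      then show ?thesis using \<open>z \<in> set q\<close> by (auto simp: inner)
    next
      case 3
      \<comment> \<open>\<open>farey_walk_meets_integer\<close> treats descending walks, so the path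
        is read from \<open>v\<close>.\<close>
      have "successively farey (rev q)"
        unfolding successively_rev by (rule successively_mono[OF qs(4)]) (meson farey_sym sympD)
      then obtain z where "z \<in> set q" "?n z = (k - 1) * ?d z"
        using farey_walk_meets_integer[OF w, of "rev q" "k - 1"] qs(1,3) q(2) v' d1 3
        by (auto simp: hd_rev last_rev)
      then have "z \<in> X (k - 1)" "z \<noteq> v" using qs(1) v' by (auto simp: X_def)
      then show ?thesis using \<open>z \<in> set q\<close> by (auto simp: inner)
    qed
  qed
  then show ?thesis using fin by (intro exI[of _ "X (k - 1) \<union> X k \<union> X (k + 1)"]) auto
qed

text \<open>Each path other than the direct edge picks a vertex of the finite separator in its
  interior; independence makes this choice injective.\<close>

lemma farey_not_infinitely_many_independent_paths:
  assumes "u \<noteq> v"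
  shows "\<not> infinitely_many_independent_paths farey u v"
proof
  assume "infinitely_many_independent_paths farey u v"
  then obtain P where P: "infinite P" "\<And>p. p \<in> P \<Longrightarrow> is_path farey u v p"
    "\<And>p q. p \<in> P \<Longrightarrow> q \<in> P \<Longrightarrow> p \<noteq> q \<Longrightarrow> inner_vertices p \<inter> inner_vertices q = {}"
    unfolding infinitely_many_independent_paths_def by auto
  obtain X where X: "finite X"
    "\<And>p. is_path farey u v p \<Longrightarrow> p \<noteq> [u, v] \<Longrightarrow> inner_vertices p \<inter> X \<noteq> {}"
    using farey_finite_separator[OF assms] by blast
  define z where "z p = (SOME x. x \<in> inner_vertices p \<inter> X)" for p
  have z: "z p \<in> inner_vertices p \<inter> X" if "p \<in> P - {[u, v]}" for p
    unfolding z_def some_in_eq using X(2)[OF P(2), of p] that by blast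
  have "inj_on z (P - {[u, v]})"
  proof (rule inj_onI, rule ccontr)
    fix p q assume "p \<in> P - {[u, v]}" "q \<in> P - {[u, v]}" "z p = z q" "p \<noteq> q"
    then show False using P(3)[of p q] z[of p] z[of q] by auto
  qed
  moreover have "z ` (P - {[u, v]}) \<subseteq> X" using z by auto
  ultimately have "finite (P - {[u, v]})" using X(1) inj_on_finite by blast
  then show False using P(1) by simp
qed

lemma farey_pi_graph: "pi_graph UNIV farey"
  using farey_inf_edge_connected farey_not_infinitely_many_independent_paths
  by (auto simp: pi_graph_def)

section \<open>Farey minors of \<open>\<Pi>\<close>-graphs\<close>

lemma pi_graph_farey_tight_minor:
  assumes pi: "pi_graph V E"
  shows "tight_minor (UNIV :: rat option set) farey V E"
proof -
  have sym: "symp E" using pi by (auto simp: pi_graph_def inf_edge_connected_def graph_def symp_def)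
  have no: "\<not> infinitely_many_independent_paths E a b" if "a \<in> V" "b \<in> V" "a \<noteq> b" for a b
    using pi that by (auto simp: pi_graph_def)
  obtain A D B where lk: "linkage E A D B" and ABV: "A \<union> D \<union> B \<subseteq> V"
    using pi_graph_linkage[OF pi] by blast
  have disj: "A \<inter> B = {}" "A \<inter> D = {}" "B \<inter> D = {}" using lk by (auto simp: linkage_def)
  have "\<not> infinitely_many_independent_paths E a b" if "a \<in> A" "b \<in> B" for a b
    using that ABV disj by (intro no) auto
  from linkage_split[OF sym lk this] obtain Z D1 D2 where
    lk1: "linkage E A D1 Z" and lk2: "linkage E Z D2 B"
    and sub: "Z \<subseteq> D" "D1 \<subseteq> D" "D2 \<subseteq> D" and D12: "D1 \<inter> D2 = {}" by blast
  have ZD: "Z \<inter> D1 = {}" "Z \<inter> D2 = {}" using lk1 lk2 by (auto simp: linkage_def)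
  have "Z \<union> D2 \<union> B \<subseteq> V" "Z \<union> D1 \<union> A \<subseteq> V" using ABV sub by auto
  \<comment> \<open>The first linkage is reversed so that both halves start with \<open>Z\<close> at
    slope 0; the far ends are \<open>B\<close> and \<open>A\<close>.\<close>
  note models = half_farey_model_exists[OF sym lk2 this(1) no]
    half_farey_model_exists[OF sym linkage_sym[OF sym lk1] this(2) no]
  obtain f where "half_farey_model E Z D2 B f" using models(1) by blast
  then have f: "f 0 1 = Z" "f 1 0 = B"
    "\<And>p d. coprime p d \<Longrightarrow> finite (f p d) \<and> f p d \<noteq> {} \<and> connected_set E (f p d)"
    "\<And>p d. coprime p d \<Longrightarrow> p > 0 \<Longrightarrow> d > 0 \<Longrightarrow> f p d \<subseteq> D2"
    "\<And>p d p' d'. coprime p d \<Longrightarrow> coprime p' d' \<Longrightarrow> (p, d) \<noteq> (p', d') \<Longrightarrow> f p d \<inter> f p' d' = {}"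
    "\<And>p d p' d'. p' * d = p * d' + 1 \<Longrightarrow> \<exists>x\<in>f p d. \<exists>y\<in>f p' d'. E x y"
    unfolding half_farey_model_def by simp_all
  obtain g where "half_farey_model E Z D1 A g" using models(2) by blast
  then have g: "g 0 1 = Z" "g 1 0 = A"
    "\<And>p d. coprime p d \<Longrightarrow> finite (g p d) \<and> g p d \<noteq> {} \<and> connected_set E (g p d)"
    "\<And>p d. coprime p d \<Longrightarrow> p > 0 \<Longrightarrow> d > 0 \<Longrightarrow> g p d \<subseteq> D1"
    "\<And>p d p' d'. coprime p d \<Longrightarrow> coprime p' d' \<Longrightarrow> (p, d) \<noteq> (p', d') \<Longrightarrow> g p d \<inter> g p' d' = {}"
    "\<And>p d p' d'. p' * d = p * d' + 1 \<Longrightarrow> \<exists>x\<in>g p d. \<exists>y\<in>g p' d'. E x y"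
    unfolding half_farey_model_def by simp_all
  define h where "h p d = (if p \<ge> 0 then f (nat p) (nat d) else g (nat (- p)) (nat d))" for p d :: int
  \<comment> \<open>Infinity receives the far ends of both halves; \<open>A \<union> B\<close> is
    connected by the edge that the linkage of \<open>A\<close> and \<open>B\<close>
    contains.\<close>
  define bs where "bs x = (case x of None \<Rightarrow> A \<union> B | Some q \<Rightarrow> h (fst (quotient_of q)) (snd (quotient_of q)))" for x
  have cop: "coprime (nat \<bar>p\<bar>) (nat d)" if "coprime p d" "d > 0" for p d :: int
    using that coprime_int_iff[of "nat \<bar>p\<bar>" "nat d"] by simp
  have h_neg: "h p d = g (nat \<bar>p\<bar>) (nat d)" if "p < 0" for p d using that by (simp add: h_def)
  have h_pos: "h p d = f (nat \<bar>p\<bar>) (nat d)" if "p \<ge> 0" for p d using that by (simp add: h_def)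
  have h_basic: "finite (h p d) \<and> h p d \<noteq> {} \<and> connected_set E (h p d)"
    if "coprime p d" "d > 0" for p d
    using f(3)[OF cop[OF that]] g(3)[OF cop[OF that]] by (cases "p < 0") (auto simp: h_neg h_pos)
  have h0: "h 0 1 = Z" using f(1) by (simp add: h_def)
  have d0: "d = 1" if "coprime 0 d" "d > 0" for d :: int using that by auto
  have h_sub: "p < 0 \<and> h p d \<subseteq> D1 \<or> p = 0 \<and> d = 1 \<and> h p d = Z \<or> p > 0 \<and> h p d \<subseteq> D2"
    if "coprime p d" "d > 0" for p d
    using f(4)[OF cop[OF that]] g(4)[OF cop[OF that]] d0 h0 that
    by (cases p "0 :: int" rule: linorder_cases) (auto simp: h_neg h_pos)
  have h_D: "h p d \<subseteq> D" if "coprime p d" "d > 0" for p d using h_sub[OF that] sub by blast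
  have h_disj: "h p d \<inter> h p' d' = {}"
    if c: "coprime p d" "d > 0" "coprime p' d'" "d' > 0" "(p, d) \<noteq> (p', d')" for p d p' d'
  proof -
    consider "p < 0" "p' < 0" | "p \<ge> 0" "p' \<ge> 0" | "p < 0" "p' \<ge> 0" | "p \<ge> 0" "p' < 0" by linarith
    then show ?thesis
    proof cases
      case 1
      then show ?thesis using c unfolding h_neg[OF 1(1)] h_neg[OF 1(2)] by (intro g cop) auto
    next
      case 2
      then show ?thesis using c unfolding h_pos[OF 2(1)] h_pos[OF 2(2)] by (intro f cop) auto
    qed (use h_sub[OF c(1,2)] h_sub[OF c(3,4)] D12 ZD in \<open>auto\<close>)
  qed
  have natmul: "nat \<bar>a\<bar> * nat b = nat \<bar>a'\<bar> * nat b' + 1"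
    if "\<bar>a\<bar> * b = \<bar>a'\<bar> * b' + 1" "b \<ge> 0" "b' \<ge> 0" for a b a' b' :: int
  proof -
    have "int (nat \<bar>a\<bar> * nat b) = int (nat \<bar>a'\<bar> * nat b' + 1)" using that by simp
    then show ?thesis by (simp only: of_nat_eq_iff)
  qed
  \<comment> \<open>A half lists its edges by increasing absolute slope, hence the symmetric
    form.\<close>
  have h_adj: "\<exists>x\<in>h p d. \<exists>y\<in>h p' d'. E x y \<or> E y x"
    if c: "d > 0" "d' > 0" and det: "\<bar>p * d' - d * p'\<bar> = 1" for p d p' d'
  proof -
    consider "p < 0" "p' < 0" | "p \<ge> 0" "p' \<ge> 0" | "p < 0" "p' \<ge> 0" | "p \<ge> 0" "p' < 0" by linarith
    then show ?thesis
    proof cases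
      case 1
      then have "\<bar>p'\<bar> * d = \<bar>p\<bar> * d' + 1 \<or> \<bar>p\<bar> * d' = \<bar>p'\<bar> * d + 1"
        using det by (auto simp: abs_if algebra_simps split: if_splits)
      then have "nat \<bar>p'\<bar> * nat d = nat \<bar>p\<bar> * nat d' + 1 \<or> nat \<bar>p\<bar> * nat d' = nat \<bar>p'\<bar> * nat d + 1"
        using c natmul[of p' d p d'] natmul[of p d' p' d] by (meson less_imp_le)
      then show ?thesis using g(6) unfolding h_neg[OF 1(1)] h_neg[OF 1(2)] by blast
    next
      case 2
      then have "\<bar>p'\<bar> * d = \<bar>p\<bar> * d' + 1 \<or> \<bar>p\<bar> * d' = \<bar>p'\<bar> * d + 1"
        using det by (auto simp: abs_if algebra_simps split: if_splits)
      then have "nat \<bar>p'\<bar> * nat d = nat \<bar>p\<bar> * nat d' + 1 \<or> nat \<bar>p\<bar> * nat d' = nat \<bar>p'\<bar> * nat d + 1"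
        using c natmul[of p' d p d'] natmul[of p d' p' d] by (meson less_imp_le)
      then show ?thesis using f(6) unfolding h_pos[OF 2(1)] h_pos[OF 2(2)] by blast
    next
      case 3
      \<comment> \<open>No Farey edge joins a negative to a positive slope: the first summand of the
        determinant already accounts for 1, which forces \<open>p' = 0\<close>. The branch set of 0
        is \<open>Z\<close>, which the negative half also owns.\<close>
      have "(-p) * d' \<ge> 1" "d * p' \<ge> 0" 
        using 3 c by (simp_all add: int_one_le_iff_zero_less mult_neg_pos)
      moreover have "(-p) * d' + d * p' = 1" using calculation det by (simp add: algebra_simps)
      ultimately have "(-p) * d' = 1" "d * p' = 0" by linarith+
      then have "p' = 0" "p = -1" "d' = 1" using c 3 pos_zmult_eq_1_iff[of "-p" d'] by auto
      then show ?thesis using g(6)[of 1 1 0 "nat d"] h0 g(1) by (auto simp: h_neg)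
    next
      case 4
      have "d * (-p') \<ge> 1" "p * d' \<ge> 0"
        using 4 c by (simp_all add: int_one_le_iff_zero_less mult_pos_neg)
      moreover have "d * (-p') + p * d' = 1" using calculation det by (simp add: algebra_simps)
      ultimately have "d * (-p') = 1" "p * d' = 0" by linarith+
      then have "p = 0" "p' = -1" "d = 1" using c 4 pos_zmult_eq_1_iff[of d "-p'"] by auto
      then show ?thesis using g(6)[of 1 1 0 "nat d'"] h0 g(1) by (auto simp: h_neg)
    qed
  qed
  \<comment> \<open>The rational neighbours of infinity are the integers; non-negative ones are
    adjacent to \<open>B\<close>, negative ones to \<open>A\<close>.\<close>
  have h_adj_inf: "\<exists>x\<in>h p 1. \<exists>y\<in>A \<union> B. E x y" for p
    using f(6)[of 1 1 "nat \<bar>p\<bar>" 0] g(6)[of 1 1 "nat \<bar>p\<bar>" 0] f(2) g(2)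
    by (cases "p < 0") (auto simp: h_neg h_pos)
  note q_cop = quotient_of_coprime[OF surjective_pairing] and q_pos = quotient_of_denom_pos'
  have "minor_via (UNIV :: rat option set) farey V E bs"
    unfolding minor_via_def
  proof (intro conjI ballI allI impI)
    fix x :: "rat option"
    obtain a b where "a \<in> A" "b \<in> B" "E a b" using lk unfolding linkage_def by blast
    then have AB: "connected_set E (A \<union> B)"
      using lk unfolding linkage_def by (intro connected_set_Un[OF sym]) auto
    have hV: "h (fst (quotient_of q)) (snd (quotient_of q)) \<subseteq> V" for q
      using h_D[OF q_cop q_pos, of q] ABV by blast
    show "bs x \<noteq> {}" "connected_set E (bs x)" "bs x \<subseteq> V"
      using h_basic[OF q_cop q_pos] hV[THEN subsetD] AB \<open>a \<in> A\<close> ABV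
      by (auto simp: bs_def split: option.splits)
  next
    fix x y :: "rat option" assume "x \<noteq> y"
    have "(fst (quotient_of q), snd (quotient_of q)) \<noteq> (fst (quotient_of r), snd (quotient_of r))"
      if "q \<noteq> r" for q r
      using that quotient_of_inject by (metis prod.collapse)
    then have hq: "h (fst (quotient_of q)) (snd (quotient_of q)) \<inter> h (fst (quotient_of r)) (snd (quotient_of r)) = {}" if "q \<noteq> r" for q r
      using that by (intro h_disj q_cop q_pos)
    have hAB: "h (fst (quotient_of q)) (snd (quotient_of q)) \<inter> (A \<union> B) = {}" for q
      using h_D[OF q_cop q_pos, of q] disj by blast
    show "bs x \<inter> bs y = {}"
      using \<open>x \<noteq> y\<close> hq hAB by (auto simp: bs_def Int_commute split: option.splits)
  next
    fix x y :: "rat option" assume xy: "farey x y"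
    have "\<exists>u\<in>bs x. \<exists>v\<in>bs y. E u v \<or> E v u"
    proof (cases x)
      case None
      then obtain r where r: "y = Some r" using xy by (cases y) (auto simp: farey_iff_det det_def)
      have "snd (quotient_of r) = 1" using xy None r q_pos[of r] by (simp add: farey_iff_det det_def)
      then show ?thesis using h_adj_inf None r by (fastforce simp: bs_def)
    next
      case (Some q)
      show ?thesis
      proof (cases y)
        case None
        have "snd (quotient_of q) = 1"
          using xy None Some q_pos[of q] by (simp add: farey_iff_det det_def)
        then show ?thesis using h_adj_inf None Some by (fastforce simp: bs_def)
      next
        case (Some r)
        then show ?thesis
          using h_adj[OF q_pos q_pos, of "fst (quotient_of q)" r q "fst (quotient_of r)"] xy \<open>x = Some q\<close>
          by (simp add: farey_iff_det det_def bs_def)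
      qed
    qed
    then show "\<exists>u\<in>bs x. \<exists>v\<in>bs y. E u v" using sym by (meson sympD)
  qed
  moreover have "finite (bs x)" for x
    using h_basic[OF q_cop q_pos] lk by (auto simp: bs_def linkage_def split: option.splits)
  ultimately show ?thesis unfolding tight_minor_def by blast
qed

section \<open>Uniqueness\<close>

lemma rtranclp_map:
  assumes "R\<^sup>*\<^sup>* x y" "\<And>x y. R x y \<Longrightarrow> Q (f x) (f y)"
  shows "Q\<^sup>*\<^sup>* (f x) (f y)"
  using assms(1) by (induction rule: rtranclp_induct)
    (auto intro: assms(2) rtranclp.rtrancl_into_rtrancl)

text \<open>This serves to copy the Farey graph onto the natural numbers. Deleted edges are pushed
  forward along \<open>g\<close>, walks are pulled back.\<close>

lemma pi_graph_bij:
  assumes g: "bij g" and pi: "pi_graph UNIV E"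
  shows "pi_graph UNIV (\<lambda>a b. E (g a) (g b))" (is "pi_graph UNIV ?E")
proof -
  have inj: "inj g" and surj: "surj g" using g by (auto simp: bij_def)
  have graph: "graph UNIV E" using pi by (simp add: pi_graph_def inf_edge_connected_def)
  have "connected_set (delete_edges ?E S) UNIV"
    if S: "finite S" "S \<subseteq> {{x, y} | x y. ?E x y}" for S
  proof -
    have "(`) g ` S \<subseteq> {{x, y} | x y. E x y}"
    proof
      fix e assume "e \<in> (`) g ` S"
      then obtain a b where "e = g ` {a, b}" "E (g a) (g b)" using S(2) by blast
      then show "e \<in> {{x, y} | x y. E x y}" by auto
    qed
    then have "connected_set (delete_edges E ((`) g ` S)) UNIV"
      using pi S(1) by (simp add: pi_graph_def inf_edge_connected_def)
    then have *: "(delete_edges E ((`) g ` S))\<^sup>*\<^sup>* x y" for x y by (simp add: connected_set_def)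
    have "delete_edges ?E S (inv g x) (inv g y)" if "delete_edges E ((`) g ` S) x y" for x y
    proof -
      have "g ` {inv g x, inv g y} = {x, y}" using surj by (simp add: surj_f_inv_f)
      then have "{inv g x, inv g y} \<notin> S" using that by (metis delete_edges_def imageI)
      then show ?thesis using that surj by (simp add: delete_edges_def surj_f_inv_f)
    qed
    then have "(delete_edges ?E S)\<^sup>*\<^sup>* (inv g x) (inv g y)" for x y
      using rtranclp_map[where f = "inv g" and Q = "delete_edges ?E S"] * by blast
    from this[of "g _" "g _"] have "(delete_edges ?E S)\<^sup>*\<^sup>* a b" for a b
      using inj by simp
    then show ?thesis by (simp add: connected_set_def)
  qed
  moreover have "graph UNIV ?E" using graph by (simp add: graph_def)
  moreover have "\<exists>a\<in>UNIV. \<exists>b\<in>UNIV. a \<noteq> (b :: 'a)"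
  proof -
    obtain x y :: 'b where "x \<noteq> y" using pi by (auto simp: pi_graph_def inf_edge_connected_def)
    then have "inv g x \<noteq> inv g y" using surj by (metis surj_f_inv_f)
    then show ?thesis by blast
  qed
  ultimately have "inf_edge_connected UNIV ?E" by (simp add: inf_edge_connected_def)
  moreover have "\<not> infinitely_many_independent_paths ?E u v" if "u \<noteq> v" for u v
  proof
    assume "infinitely_many_independent_paths ?E u v"
    then obtain P where P: "infinite P" "\<And>p. p \<in> P \<Longrightarrow> is_path ?E u v p"
      "\<And>p q. p \<in> P \<Longrightarrow> q \<in> P \<Longrightarrow> p \<noteq> q \<Longrightarrow> inner_vertices p \<inter> inner_vertices q = {}"
      unfolding infinitely_many_independent_paths_def by auto
    have inner: "inner_vertices (map g p) = g ` inner_vertices p" for p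
      by (simp add: inner_vertices_def map_tl[symmetric] map_butlast[symmetric])
    have "infinite (map g ` P)"
      using P(1) inj by (meson finite_imageD inj_mapI inj_on_subset subset_UNIV)
    moreover have "is_path E (g u) (g v) q" if "q \<in> map g ` P" for q
    proof -
      obtain p where p: "p \<in> P" "q = map g p" using \<open>q \<in> map g ` P\<close> by auto
      have "distinct (map g p)" using P(2)[OF p(1)] inj
        by (auto simp: is_path_def distinct_map intro: inj_on_subset)
      then show ?thesis using P(2)[OF p(1)]
        by (simp add: p(2) is_path_def hd_map last_map successively_map)
    qed
    moreover have "inner_vertices q \<inter> inner_vertices q' = {}"
      if "q \<in> map g ` P" "q' \<in> map g ` P" "q \<noteq> q'" for q q'
    proof -
      obtain p p' where "p \<in> P" "p' \<in> P" "q = map g p" "q' = map g p'"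
        using \<open>q \<in> map g ` P\<close> \<open>q' \<in> map g ` P\<close> by auto
      then show ?thesis
        using P(3)[of p p'] \<open>q \<noteq> q'\<close> inj by (auto simp: inner image_Int[symmetric])
    qed
    ultimately have "infinitely_many_independent_paths E (g u) (g v)"
      unfolding infinitely_many_independent_paths_def
      by (intro exI[of _ "map g ` P"] conjI ballI impI) auto
    moreover have "g u \<noteq> g v" using \<open>u \<noteq> v\<close> inj by (simp add: inj_eq)
    ultimately show False using pi by (auto simp: pi_graph_def)
  qed
  ultimately show ?thesis by (auto simp: pi_graph_def)
qed

lemma tight_minor_bij:
  assumes g: "bij g" and tm: "tight_minor V E UNIV (\<lambda>a b. F (g a) (g b))"
  shows "tight_minor V E UNIV F"
proof -
  have inj: "inj g" using g by (simp add: bij_def)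
  obtain br where br: "minor_via V E UNIV (\<lambda>a b. F (g a) (g b)) br" "\<And>h. h \<in> V \<Longrightarrow> finite (br h)"
    using tm by (auto simp: tight_minor_def)
  have "connected_set F (g ` br h)" if "h \<in> V" for h
    unfolding connected_set_def
  proof (intro ballI)
    fix x y assume "x \<in> g ` br h" "y \<in> g ` br h"
    then obtain a b where ab: "a \<in> br h" "b \<in> br h" "x = g a" "y = g b" by auto
    then have "(\<lambda>a b. F (g a) (g b) \<and> a \<in> br h \<and> b \<in> br h)\<^sup>*\<^sup>* a b"
      using br(1) that by (auto simp: minor_via_def connected_set_def)
    then show "(\<lambda>a b. F a b \<and> a \<in> g ` br h \<and> b \<in> g ` br h)\<^sup>*\<^sup>* x y"
      unfolding ab by (rule rtranclp_map) auto
  qed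
  then have "minor_via V E UNIV F (\<lambda>h. g ` br h)"
    using br(1) inj by (auto simp: minor_via_def image_Int[symmetric])
  then show ?thesis using br(2) by (auto simp: tight_minor_def)
qed

theorem theorem3p2:
  shows "pi_graph (UNIV :: rat option set) farey
    \<and> (\<forall>(VG :: 'b set) EG. pi_graph VG EG \<longrightarrow> tight_minor (UNIV :: rat option set) farey VG EG)
    \<and> (\<forall>(VH :: 'a set) EH. pi_graph VH EH
          \<and> (\<forall>(VG :: nat set) EG. pi_graph VG EG \<longrightarrow> tight_minor VH EH VG EG)
          \<longrightarrow> tightly_minor_equivalent VH EH (UNIV :: rat option set) farey)"
proof (intro conjI allI impI)
  fix VH :: "'a set" and EH
  assume H: "pi_graph VH EH
    \<and> (\<forall>(VG :: nat set) EG. pi_graph VG EG \<longrightarrow> tight_minor VH EH VG EG)"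
  \<comment> \<open>Typicality is assumed for graphs with vertices in \<open>nat\<close>, so an
    enumeration of the countable vertex set carries the Farey graph there and the resulting minor
    back.\<close>
  have "infinite (UNIV :: rat option set)" by (simp add: infinite_UNIV_char_0)
  then have "bij (from_nat_into (UNIV :: rat option set))"
    by (simp add: bij_betw_from_nat_into)
  then obtain g :: "nat \<Rightarrow> rat option" where g: "bij g" by blast
  have "tight_minor VH EH UNIV (\<lambda>a b. farey (g a) (g b))"
    using H pi_graph_bij[OF g farey_pi_graph] by blast
  then have "tight_minor VH EH UNIV farey" by (rule tight_minor_bij[OF g])
  then show "tightly_minor_equivalent VH EH UNIV farey"
    using H pi_graph_farey_tight_minor by (auto simp: tightly_minor_equivalent_def)
qed (use farey_pi_graph pi_graph_farey_tight_minor in auto)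

end
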